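(* Let $\mathsf{A}\subseteq\Phi_\omega$ be a bounded downset of constructive ordinals. Then $\mathrm{PredR}_{\mathsf{A}}\subseteq\mathcal{E}_{l(\mathsf{A})+2}$.
   Context: Constructive ordinals: $\Omega$ is the set of infinitary terms generated by $0$, successor $\alpha+1$, and limits $\langle\alpha_i\rangle_{i\in\mathbb{N}}$; equality is syntactic. $\prec$ is the transitive closure of $\alpha\prec\alpha+1$ and $\alpha_m\prec\langle\alpha_i\rangle_i$; downsets are subsets closed downward under $\prec$. $o(0)=0$, $o(n+1)=o(n)+1$, $\omega=\langle o(i+1)\rangle_i$. Arithmetic: $\alpha+0=\alpha$, $\alpha+(\beta+1)=(\alpha+\beta)+1$, $\alpha+\langle\beta_i\rangle=\langle\alpha+\beta_i\rangle$; $\alpha\cdot0=0$, $\alpha\cdot(\beta+1)=\alpha\cdot\beta+\alpha$, $\alpha\cdot\langle\beta_i\rangle=\langle\alpha\cdot\beta_i\rangle$; $\alpha^0=o(1)$, $\alpha^{\beta+1}=\alpha^\beta\cdot\alpha$, $\alpha^{\langle\beta_i\rangle}=\langle\alpha^{\beta_i}\rangle$. Veblen functions: $\phi_0(\gamma)=\omega^\gamma$; $\phi_{k+1}(0)=\langle\phi_k^{(i)}(0)\rangle_i$; $\phi_{k+1}(\gamma+1)=\langle\phi_k^{(i)}(\phi_{k+1}(\gamma)+1)\rangle_i$; $\phi_{k+1}(\langle\gamma_i\rangle)=\langle\phi_{k+1}(\gamma_i)\rangle_i$. $\Phi_\omega$ (resp. $\Phi_k$): smallest set containing $0$ closed under $+$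 and all $\phi_i$ (resp. $\phi_i$, $i<k$). $\Psi_\omega$: closure of $\{0\}\cup\{\omega^{o(p)}:p\in\mathbb{N}\}$ under $+$. A downset $\mathsf{A}\subseteq\Phi_\omega$ is bounded if $\mathsf{A}\subseteq\Phi_k$ for some $k\ge1$; then $l(\mathsf{A})=0$ if $\mathsf{A}\subseteq\Psi_\omega$, else the least $k\ge1$ with $\mathsf{A}\subseteq\Phi_k$. $\mathcal{C}_{\mathsf{A}}$: functions $f(\bar\mu,\bar n;\bar a)$ (ordinal arguments in $\mathsf{A}$, normal numeral arguments $\bar n$, safe numeral arguments $\bar a$, values in $\mathbb{N}$); smallest class containing nullary $0$, projections onto numeral arguments, $s(;a)=a+1$, $P(;0)=0$, $P(;a+1)=a$, $C(;a,b,c)=b$ if $a=0$ else $c$, closed under predicative ordinal recursion ($f(0,\bar\nu,\bar n;\bar a)=g(\bar\nu,\bar n;\bar a)$, $f(\mu+1,\bar\nu,\bar n;\bar a)=h_{suc}(\mu,\bar\nu,\bar n;f(\mu,\bar\nu,\bar n;\bar a),\bar a)$, $f(\langle\mu_i\rangle,\bar\nu,\bar n;\bar a)=h_{lim}(\langle\mu_i\rangle,\bar\nu,\bar n;f(\mu_{q(\bar n;)},\bar\nu,\bar n;\bar a),\bar a)$, $q$ with only normal numeral arguments), safe composition $f(\bar\mu,\bar n;\bar a)=h(\bar\mu,\bar s(\bar\mu,\bar n;);\bar t(\bar\mu,\bar n;\bar a))$, substitution of a constant in $\mathsf{A}$ for an ordinal argument, and exchange/weakening/contraction of ordinal arguments.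 $\mathrm{PredR}_{\mathsf{A}}$: the $f:\mathbb{N}^k\to\mathbb{N}$ with $f(\bar n)=\hat f(\bar n;)$ for some $\hat f\in\mathcal{C}_{\mathsf{A}}$ with no ordinal and no safe arguments. Grzegorczyk hierarchy: $h_1(n)=n^2+2$, $h_{k+1}(n)=h_k^{(n)}(2)$; $\mathcal{E}_k$ ($k\ge2$) is the closure of zero, successor, projections and $h_1,\dots,h_{k-1}$ under composition and bounded primitive recursion.
   Formalization: Addition is included among the initial functions of the Grzegorczyk classes E_k, as is standard; with only zero, successor, projections and h_1,…,h_{k-1} every function is bounded in a single argument, and the claim fails (e.g. for the conditional C or x+y). *)

theory Defs
  imports Main
begin

section \<open>Constructive ordinals\<close>

datatype cord = OZero | OSuc cord | OLim "nat \<Rightarrow> cord"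

inductive cord_step :: "cord \<Rightarrow> cord \<Rightarrow> bool" where
  "cord_step \<alpha> (OSuc \<alpha>)"
| "cord_step (\<alpha> m) (OLim \<alpha>)"

definition cord_prec :: "cord \<Rightarrow> cord \<Rightarrow> bool" (infix \<open>\<prec>\<close> 50) where
  "(\<prec>) = cord_step\<^sup>+\<^sup>+"

definition downset :: "cord set \<Rightarrow> bool" where
  "downset A \<longleftrightarrow> (\<forall>\<alpha>\<in>A. \<forall>\<beta>. \<beta> \<prec> \<alpha> \<longrightarrow> \<beta> \<in> A)"

primrec onat :: "nat \<Rightarrow> cord" where
  "onat 0 = OZero"
| "onat (Suc n) = OSuc (onat n)"

definition omega :: cord where
  "omega = OLim (\<lambda>i. onat (i + 1))"

primrec oadd :: "cord \<Rightarrow> cord \<Rightarrow> cord" where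
  "oadd \<alpha> OZero = \<alpha>"
| "oadd \<alpha> (OSuc \<beta>) = OSuc (oadd \<alpha> \<beta>)"
| "oadd \<alpha> (OLim \<beta>) = OLim (\<lambda>i. oadd \<alpha> (\<beta> i))"

primrec omul :: "cord \<Rightarrow> cord \<Rightarrow> cord" where
  "omul \<alpha> OZero = OZero"
| "omul \<alpha> (OSuc \<beta>) = oadd (omul \<alpha> \<beta>) \<alpha>"
| "omul \<alpha> (OLim \<beta>) = OLim (\<lambda>i. omul \<alpha> (\<beta> i))"

primrec opow :: "cord \<Rightarrow> cord \<Rightarrow> cord" where
  "opow \<alpha> OZero = onat 1"
| "opow \<alpha> (OSuc \<beta>) = omul (opow \<alpha> \<beta>) \<alpha>"
| "opow \<alpha> (OLim \<beta>) = OLim (\<lambda>i. opow \<alpha> (\<beta> i))"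

text \<open>\<open>veblen_next F\<close> is \<open>\<phi>\<^bsub>k+1\<^esub>\<close> when \<open>F\<close> is \<open>\<phi>\<^sub>k\<close>.\<close>

primrec veblen_next :: "(cord \<Rightarrow> cord) \<Rightarrow> cord \<Rightarrow> cord" where
  "veblen_next F OZero = OLim (\<lambda>i. (F ^^ i) OZero)"
| "veblen_next F (OSuc \<gamma>) = OLim (\<lambda>i. (F ^^ i) (OSuc (veblen_next F \<gamma>)))"
| "veblen_next F (OLim \<gamma>) = OLim (\<lambda>i. veblen_next F (\<gamma> i))"

primrec veblen :: "nat \<Rightarrow> cord \<Rightarrow> cord" where
  "veblen 0 = opow omega"
| "veblen (Suc k) = veblen_next (veblen k)"

inductive_set veblen_closure :: "nat set \<Rightarrow> cord set" for I :: "nat set" where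
  "OZero \<in> veblen_closure I"
| "\<alpha> \<in> veblen_closure I \<Longrightarrow> \<beta> \<in> veblen_closure I \<Longrightarrow> oadd \<alpha> \<beta> \<in> veblen_closure I"
| "i \<in> I \<Longrightarrow> \<alpha> \<in> veblen_closure I \<Longrightarrow> veblen i \<alpha> \<in> veblen_closure I"

definition Phi :: "nat \<Rightarrow> cord set" where
  "Phi k = veblen_closure {..<k}"

definition Phi_omega :: "cord set" where
  "Phi_omega = veblen_closure UNIV"

inductive_set Psi_omega :: "cord set" where
  "OZero \<in> Psi_omega"
| "opow omega (onat p) \<in> Psi_omega"
| "\<alpha> \<in> Psi_omega \<Longrightarrow> \<beta> \<in> Psi_omega \<Longrightarrow> oadd \<alpha> \<beta> \<in> Psi_omega"

definition bounded_ords :: "cord set \<Rightarrow> bool" where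
  "bounded_ords A \<longleftrightarrow> (\<exists>k\<ge>1. A \<subseteq> Phi k)"

definition level :: "cord set \<Rightarrow> nat" where
  "level A = (if A \<subseteq> Psi_omega then 0 else (LEAST k. k \<ge> 1 \<and> A \<subseteq> Phi k))"

section \<open>Predicative ordinal recursion\<close>

text \<open>
  \<open>pred_class A p m k f\<close>: the function \<open>f(\<mu>\<^sub>1..\<mu>\<^sub>p, n\<^sub>1..n\<^sub>m; a\<^sub>1..a\<^sub>k)\<close> belongs to the class
  generated over \<open>A\<close>. The three argument groups are passed as lists, and a function is
  identified with its restriction to lists of the right lengths, with ordinals from \<open>A\<close>:
  each rule prescribes the values of \<open>f\<close> on that domain (\<open>args\<close>) only.
\<close>

definition args :: "cord set \<Rightarrow> nat \<Rightarrow> nat \<Rightarrow> nat \<Rightarrow> (cord list \<times> nat list \<times> nat list) set" where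
  "args A p m k = {(\<mu>s, ns, as). length \<mu>s = p \<and> set \<mu>s \<subseteq> A \<and> length ns = m \<and> length as = k}"

inductive pred_class ::
  "cord set \<Rightarrow> nat \<Rightarrow> nat \<Rightarrow> nat \<Rightarrow> (cord list \<Rightarrow> nat list \<Rightarrow> nat list \<Rightarrow> nat) \<Rightarrow> bool"
  for A :: "cord set" where
  zero:
    "f [] [] [] = 0 \<Longrightarrow> pred_class A 0 0 0 f"
| proj_normal:
    "i < m \<Longrightarrow> \<forall>(\<mu>s, ns, as) \<in> args A p m k. f \<mu>s ns as = ns ! i \<Longrightarrow> pred_class A p m k f"
| proj_safe:
    "j < k \<Longrightarrow> \<forall>(\<mu>s, ns, as) \<in> args A p m k. f \<mu>s ns as = as ! j \<Longrightarrow> pred_class A p m k f"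
| succ:
    "\<forall>a. f [] [] [a] = a + 1 \<Longrightarrow> pred_class A 0 0 1 f"
| pred:
    "f [] [] [0] = 0 \<Longrightarrow> \<forall>a. f [] [] [a + 1] = a \<Longrightarrow> pred_class A 0 0 1 f"
| cond:
    "\<forall>a b c. f [] [] [a, b, c] = (if a = 0 then b else c) \<Longrightarrow> pred_class A 0 0 3 f"
| ord_rec:
    "pred_class A p m k g \<Longrightarrow>
     pred_class A (Suc p) m (Suc k) hsuc \<Longrightarrow>
     pred_class A (Suc p) m (Suc k) hlim \<Longrightarrow>
     pred_class A 0 m 0 q \<Longrightarrow>
     \<forall>(\<nu>s, ns, as) \<in> args A p m k.
       (OZero \<in> A \<longrightarrow> f (OZero # \<nu>s) ns as = g \<nu>s ns as) \<and>
       (\<forall>\<mu>. OSuc \<mu> \<in> A \<longrightarrow>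
          f (OSuc \<mu> # \<nu>s) ns as = hsuc (\<mu> # \<nu>s) ns (f (\<mu> # \<nu>s) ns as # as)) \<and>
       (\<forall>\<mu>. OLim \<mu> \<in> A \<longrightarrow>
          f (OLim \<mu> # \<nu>s) ns as
            = hlim (OLim \<mu> # \<nu>s) ns (f (\<mu> (q [] ns []) # \<nu>s) ns as # as)) \<Longrightarrow>
     pred_class A (Suc p) m k f"
| safe_comp:
    "pred_class A p (length ss) (length ts) h \<Longrightarrow>
     \<forall>s \<in> set ss. pred_class A p m 0 s \<Longrightarrow>
     \<forall>t \<in> set ts. pred_class A p m k t \<Longrightarrow>
     \<forall>(\<mu>s, ns, as) \<in> args A p m k.
       f \<mu>s ns as = h \<mu>s (map (\<lambda>s. s \<mu>s ns []) ss) (map (\<lambda>t. t \<mu>s ns as) ts) \<Longrightarrow>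
     pred_class A p m k f"
| subst_const:
    "pred_class A (Suc p) m k g \<Longrightarrow> \<alpha> \<in> A \<Longrightarrow> i \<le> p \<Longrightarrow>
     \<forall>(\<mu>s, ns, as) \<in> args A p m k. f \<mu>s ns as = g (take i \<mu>s @ \<alpha> # drop i \<mu>s) ns as \<Longrightarrow>
     pred_class A p m k f"
| exchange:
    "pred_class A p m k g \<Longrightarrow> i < p \<Longrightarrow> j < p \<Longrightarrow>
     \<forall>(\<mu>s, ns, as) \<in> args A p m k. f \<mu>s ns as = g (\<mu>s[i := \<mu>s ! j, j := \<mu>s ! i]) ns as \<Longrightarrow>
     pred_class A p m k f"
| weakening:
    "pred_class A p m k g \<Longrightarrow>
     \<forall>(\<mu>s, ns, as) \<in> args A (Suc p) m k. f \<mu>s ns as = g (tl \<mu>s) ns as \<Longrightarrow>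
     pred_class A (Suc p) m k f"
| contraction:
    "pred_class A (Suc (Suc p)) m k g \<Longrightarrow>
     \<forall>(\<mu>s, ns, as) \<in> args A (Suc p) m k. f \<mu>s ns as = g (hd \<mu>s # \<mu>s) ns as \<Longrightarrow>
     pred_class A (Suc p) m k f"

text \<open>
  A number-theoretic function \<open>\<nat>\<^sup>k \<rightarrow> \<nat>\<close> is a pair of its arity \<open>k\<close> and a function on lists,
  of which only the values on lists of length \<open>k\<close> matter.
\<close>

definition PredR :: "cord set \<Rightarrow> (nat \<times> (nat list \<Rightarrow> nat)) set" where
  "PredR A = {(k, f). \<exists>f'. pred_class A 0 k 0 f' \<and> (\<forall>ns. length ns = k \<longrightarrow> f ns = f' [] ns [])}"

section \<open>The Grzegorczyk hierarchy\<close>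

text \<open>The functions \<open>h\<^sub>1, h\<^sub>2, \<dots>\<close>; the value at index \<open>0\<close> is unspecified.\<close>

fun grz_h :: "nat \<Rightarrow> nat \<Rightarrow> nat" where
  "grz_h (Suc 0) = (\<lambda>n. n ^ 2 + 2)"
| "grz_h (Suc (Suc k)) = (\<lambda>n. (grz_h (Suc k) ^^ n) 2)"

text \<open>
  Addition is an initial function at every level, as in the standard presentation of the
  hierarchy, where it precedes \<open>h\<^sub>1\<close> as \<open>h\<^sub>0\<close>. It cannot be dropped: zero, successor, projections
  and the \<open>h\<^sub>j\<close> each depend on at most one argument, so without it composition and bounded
  recursion would only yield functions bounded by a function of a single argument, and
  \<open>x + y\<close> would belong to no level.
\<close>

inductive grz_class :: "nat \<Rightarrow> nat \<Rightarrow> (nat list \<Rightarrow> nat) \<Rightarrow> bool" for k :: nat where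
  zero:
    "f [] = 0 \<Longrightarrow> grz_class k 0 f"
| succ:
    "\<forall>x. f [x] = x + 1 \<Longrightarrow> grz_class k 1 f"
| proj:
    "i < n \<Longrightarrow> \<forall>xs. length xs = n \<longrightarrow> f xs = xs ! i \<Longrightarrow> grz_class k n f"
| add:
    "\<forall>x y. f [x, y] = x + y \<Longrightarrow> grz_class k 2 f"
| h:
    "1 \<le> j \<Longrightarrow> j < k \<Longrightarrow> \<forall>x. f [x] = grz_h j x \<Longrightarrow> grz_class k 1 f"
| comp:
    "grz_class k (length gs) u \<Longrightarrow> \<forall>g \<in> set gs. grz_class k n g \<Longrightarrow>
     \<forall>xs. length xs = n \<longrightarrow> f xs = u (map (\<lambda>g. g xs) gs) \<Longrightarrow>
     grz_class k n f"
| bounded_rec: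
    "grz_class k n g \<Longrightarrow> grz_class k (Suc (Suc n)) u \<Longrightarrow> grz_class k (Suc n) b \<Longrightarrow>
     \<forall>xs. length xs = n \<longrightarrow>
       f (0 # xs) = g xs \<and>
       (\<forall>y. f (Suc y # xs) = u (y # f (y # xs) # xs)) \<and>
       (\<forall>y. f (y # xs) \<le> b (y # xs)) \<Longrightarrow>
     grz_class k (Suc n) f"

definition Grz :: "nat \<Rightarrow> (nat \<times> (nat list \<Rightarrow> nat)) set" where
  "Grz k = {(n, f). grz_class k n f}"

end

theory Submission
  imports Defs
begin

text \<open>
  A recursion on an ordinal \<open>\<mu>\<close> whose limits are resolved at \<open>x = q(n)\<close> unfolds along the finite
  descent from \<open>\<mu>\<close> with index \<open>x\<close>, whose length is governed by the slow-growing hierarchy. Safe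
  arguments enter values only through their maximum, \<open>f(\<mu>,n;a) \<le> b(\<mu>,n) + max a\<close>, so the
  recursion can be carried out by bounded recursion on codes of ordinals, provided that the
  descent and its length are computable in the Grzegorczyk class at hand. A derivation involves
  only finitely many ordinal constants, so only the ordinals below these need codes. For
  \<open>\<Psi>\<^sub>\<omega>\<close> tuples of coefficients of bounded length suffice, and everything is polynomial. For \<open>\<Phi>\<^sub>k\<close>
  the codes are terms with a marked position, and the descent is dominated by replacing
  \<open>\<phi>\<^sub>0\<close> by exponentiation and \<open>\<phi>\<^bsub>i+1\<^esub>\<close> by iteration of the counterpart of \<open>\<phi>\<^sub>i\<close>, each iteration
  raising the class by one.
\<close>

section \<open>Closure properties of the Grzegorczyk classes\<close>

text \<open>Different recursions resolve their limits at different indices: an ordinal lowered at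
  index x is handed to a step function, which may lower it further at another index. Bounds for
  lengths and codes must therefore hold for every code reachable with mixed indices, although a
  single descent keeps its index. The interface \<open>code_system\<close> is shaped by this;
  transitions and bounds must be computable there, while the termination rank and the set of
  legitimate codes are used in proofs alone. A second obstacle is that equality of ordinals is
  syntactic: 1 + \<omega> differs from \<omega>, so sums cannot be brought to Cantor normal form and
  the codes have to follow them literally. The marked position turns one step of the descent into a
  case distinction on a bounded number of constructors; finding the place to reduce costs silent
  steps instead of a recursion on codes. The number 2 in the level comes from the base of the
  iteration: exponentiation lies in class 3, so the counterparts of all phi_i with i < k lie in
  class k + 2.\<close>

text \<open>Composing with all projections rebuilds an argument list of the right length, so
  membership depends only on the values at the proper arity.\<close>

lemma grz_cong:
  assumes "grz_class k n f" "\<And>xs. length xs = n \<Longrightarrow> f xs = f' xs"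
  shows "grz_class k n f'"
proof (rule grz_class.comp)
  show "grz_class k (length (map (\<lambda>i xs. xs ! i) [0..<n])) f"
    using assms(1) by simp
  show "\<forall>g \<in> set (map (\<lambda>i xs. xs ! i) [0..<n]). grz_class k n g"
    by (auto intro: grz_class.proj)
  show "\<forall>xs. length xs = n \<longrightarrow> f' xs = f (map (\<lambda>g. g xs) (map (\<lambda>i xs. xs ! i) [0..<n]))"
  proof (intro allI impI)
    fix xs :: "nat list" assume l: "length xs = n"
    have "map (\<lambda>g. g xs) (map (\<lambda>i xs. xs ! i) [0..<n]) = xs"
      using l by (intro nth_equalityI) simp_all
    then show "f' xs = f (map (\<lambda>g. g xs) (map (\<lambda>i xs. xs ! i) [0..<n]))"
      using assms(2)[OF l] by simp
  qed
qed

lemma grz_mono: "grz_class j n f \<Longrightarrow> j \<le> k \<Longrightarrow> grz_class k n f"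
proof (induction rule: grz_class.induct)
  case (succ f) then show ?case by (intro grz_class.succ) auto
next
  case (h j f) then show ?case by (intro grz_class.h[of j]) auto
next
  case (comp gs u n f) then show ?case by (intro grz_class.comp[of k gs u n f]) auto
next
  case (bounded_rec n g u b f) then show ?case by (intro grz_class.bounded_rec[of k n g u b f]) auto
qed (auto intro: grz_class.intros)

text \<open>Vector valued maps on argument lists. Composition then needs the single rule
  \<open>grz_compose\<close>, and later rearrangements of arguments are assembled from
  \<open>take\<close>, \<open>drop\<close>, \<open>tl\<close>, \<open>#\<close> and append.\<close>

definition grz_list :: "nat \<Rightarrow> nat \<Rightarrow> nat \<Rightarrow> (nat list \<Rightarrow> nat list) \<Rightarrow> bool" where
  "grz_list k n m E \<longleftrightarrow> (\<forall>i<m. grz_class k n (\<lambda>xs. E xs ! i)) \<and>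
     (\<forall>xs. length xs = n \<longrightarrow> length (E xs) = m)"

lemma grz_compose:
  assumes "grz_class k m F" "grz_list k n m E"
  shows "grz_class k n (\<lambda>xs. F (E xs))"
proof (rule grz_class.comp)
  show "grz_class k (length (map (\<lambda>i xs. E xs ! i) [0..<m])) F"
    using assms(1) by simp
  show "\<forall>g \<in> set (map (\<lambda>i xs. E xs ! i) [0..<m]). grz_class k n g"
    using assms(2) unfolding grz_list_def by simp
  show "\<forall>xs. length xs = n \<longrightarrow> F (E xs) = F (map (\<lambda>g. g xs) (map (\<lambda>i xs. E xs ! i) [0..<m]))"
  proof (intro allI impI)
    fix xs :: "nat list" assume l: "length xs = n"
    have "length (E xs) = m" using l assms(2) unfolding grz_list_def by blast
    then have "map (\<lambda>g. g xs) (map (\<lambda>i xs. E xs ! i) [0..<m]) = E xs"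
      by (intro nth_equalityI) simp_all
    then show "F (E xs) = F (map (\<lambda>g. g xs) (map (\<lambda>i xs. E xs ! i) [0..<m]))"
      by simp
  qed
qed

lemma grz_nth: "i < n \<Longrightarrow> grz_class k n (\<lambda>xs. xs ! i)"
  by (auto intro: grz_class.proj)

lemma grz_class_Suc: "grz_class k (Suc 0) (\<lambda>l. Suc (l ! 0))"
  using grz_class.succ[of "\<lambda>l. Suc (l ! 0)" k] by simp

lemma grz_const: "grz_class k n (\<lambda>xs. c)"
proof (induction c)
  case 0
  have "grz_class k n (\<lambda>xs. (\<lambda>_. 0) [])"
    by (rule grz_compose[where E = "\<lambda>_. []"]) (auto intro: grz_class.zero simp: grz_list_def)
  then show ?case by simp
next
  case (Suc c)
  have "grz_class k n (\<lambda>xs. (\<lambda>l. Suc (l ! 0)) [c])"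
    by (rule grz_compose[OF grz_class_Suc]) (use Suc in \<open>simp add: grz_list_def\<close>)
  then show ?case by simp
qed

lemma grz_list_Nil: "grz_list k n 0 (\<lambda>xs. [])"
  by (simp add: grz_list_def)

lemma grz_list_Cons:
  "grz_class k n e \<Longrightarrow> grz_list k n m E \<Longrightarrow> grz_list k n (Suc m) (\<lambda>xs. e xs # E xs)"
  unfolding grz_list_def
proof (intro conjI allI impI)
  fix i assume *: "grz_class k n e" "i < Suc m" "(\<forall>i<m. grz_class k n (\<lambda>xs. E xs ! i)) \<and>
    (\<forall>xs. length xs = n \<longrightarrow> length (E xs) = m)"
  then show "grz_class k n (\<lambda>xs. (e xs # E xs) ! i)" by (cases i) simp_all
qed simp

lemma grz_list_append:
  assumes "grz_list k n m E" "grz_list k n m' E'"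
  shows "grz_list k n (m + m') (\<lambda>xs. E xs @ E' xs)"
  unfolding grz_list_def
proof (intro conjI allI impI)
  fix i assume i: "i < m + m'"
  show "grz_class k n (\<lambda>xs. (E xs @ E' xs) ! i)"
  proof (cases "i < m")
    case True
    with assms show ?thesis
      by (intro grz_cong[of k n "\<lambda>xs. E xs ! i" "\<lambda>xs. (E xs @ E' xs) ! i"])
        (simp_all add: grz_list_def nth_append)
  next
    case False
    with i assms show ?thesis
      by (intro grz_cong[of k n "\<lambda>xs. E' xs ! (i - m)" "\<lambda>xs. (E xs @ E' xs) ! i"])
        (simp_all add: grz_list_def nth_append)
  qed
qed (use assms in \<open>auto simp: grz_list_def\<close>)

lemma grz_list_map:
  "(\<And>s. s \<in> set ss \<Longrightarrow> grz_class k n (G s)) \<Longrightarrow> grz_list k n (length ss) (\<lambda>xs. map (\<lambda>s. G s xs) ss)"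
  by (simp add: grz_list_def)

lemma grz_list_id: "grz_list k n n (\<lambda>xs. xs)"
  by (auto simp: grz_list_def intro: grz_nth)

lemma grz_list_compose:
  "grz_list k n m E \<Longrightarrow> grz_list k m l E' \<Longrightarrow> grz_list k n l (\<lambda>xs. E' (E xs))"
  unfolding grz_list_def[of k m] grz_list_def[of k n l]
  using grz_compose[where F = "\<lambda>xs. E' xs ! i" and E = E for i] by (auto simp: grz_list_def)

lemma grz_list_take:
  assumes "grz_list k n m E" "j \<le> m"
  shows "grz_list k n j (\<lambda>xs. take j (E xs))"
  using assms by (simp add: grz_list_def)

lemma grz_list_drop:
  assumes "grz_list k n m E" "m = j + l"
  shows "grz_list k n l (\<lambda>xs. drop j (E xs))"
  unfolding grz_list_def
proof (intro conjI allI impI)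
  fix i assume "i < l"
  with assms show "grz_class k n (\<lambda>xs. drop j (E xs) ! i)"
    by (intro grz_cong[of k n "\<lambda>xs. E xs ! (j + i)" "\<lambda>xs. drop j (E xs) ! i"])
      (simp_all add: grz_list_def)
qed (use assms in \<open>auto simp: grz_list_def\<close>)

lemma grz_list_tl:
  assumes "grz_list k n (Suc m) E"
  shows "grz_list k n m (\<lambda>xs. tl (E xs))"
proof -
  have "tl l = drop 1 l" for l :: "nat list" by (cases l) simp_all
  then show ?thesis using grz_list_drop[OF assms, of 1 m] by (simp del: One_nat_def)
qed

lemma grz_list_swap:
  assumes "i < n" "j < n"
  shows "grz_list k n n (\<lambda>xs. xs[i := xs ! j, j := xs ! i])"
  unfolding grz_list_def
proof (intro conjI allI impI)
  fix l assume "l < n"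
  with assms show "grz_class k n (\<lambda>xs. xs[i := xs ! j, j := xs ! i] ! l)"
    by (intro grz_cong[OF grz_nth[of "if l = j then i else if l = i then j else l"]])
      (auto simp: nth_list_update)
qed simp

lemma grz_tl: "grz_class k n f \<Longrightarrow> grz_class k (Suc n) (\<lambda>xs. f (tl xs))"
  using grz_compose[where F = f and E = tl and m = n and n = "Suc n" and k = k]
    grz_list_tl[where E = "\<lambda>xs. xs", OF grz_list_id] by simp

lemma grz_lift1:
  assumes "grz_class k 1 (\<lambda>l. F (l ! 0))" "grz_class k n f"
  shows "grz_class k n (\<lambda>xs. F (f xs))"
proof -
  have "grz_class k n (\<lambda>xs. (\<lambda>l. F (l ! 0)) [f xs])"
    by (rule grz_compose[OF assms(1)]) (use grz_list_Cons[OF assms(2) grz_list_Nil] in simp)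
  then show ?thesis by simp
qed

lemma grz_lift2:
  assumes "grz_class k 2 (\<lambda>l. F (l ! 0) (l ! 1))" "grz_class k n f" "grz_class k n g"
  shows "grz_class k n (\<lambda>xs. F (f xs) (g xs))"
proof -
  have "grz_class k n (\<lambda>xs. (\<lambda>l. F (l ! 0) (l ! 1)) [f xs, g xs])"
    by (rule grz_compose[OF assms(1)])
      (use grz_list_Cons[OF assms(2) grz_list_Cons[OF assms(3) grz_list_Nil]] in
        \<open>simp add: numeral_2_eq_2\<close>)
  then show ?thesis by simp
qed

section \<open>Elementary arithmetic and case distinction\<close>

lemma grz_Suc: "grz_class k n f \<Longrightarrow> grz_class k n (\<lambda>xs. Suc (f xs))"
  by (rule grz_lift1[where F = Suc]) (simp_all add: grz_class_Suc)

lemma grz_add: "grz_class k n f \<Longrightarrow> grz_class k n g \<Longrightarrow> grz_class k n (\<lambda>xs. f xs + g xs)"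
  by (rule grz_lift2[where F = "(+)"]) (auto intro: grz_class.add)

lemma grz_grz_h:
  "grz_class k n f \<Longrightarrow> 1 \<le> j \<Longrightarrow> j < k \<Longrightarrow> grz_class k n (\<lambda>xs. grz_h j (f xs))"
  using grz_lift1[where F = "grz_h j", OF grz_class.h[of j k "\<lambda>l. grz_h j (l ! 0)"]]
  by (simp del: grz_h.simps)

lemma grz_rec:
  assumes "grz_class k n g" "grz_class k (Suc (Suc n)) u" "grz_class k (Suc n) b"
    and "\<And>xs. length xs = n \<Longrightarrow> R 0 xs = g xs"
    and "\<And>xs y. length xs = n \<Longrightarrow> R (Suc y) xs = u (y # R y xs # xs)"
    and "\<And>xs y. length xs = n \<Longrightarrow> R y xs \<le> b (y # xs)"
    and "grz_class k n t"
  shows "grz_class k n (\<lambda>xs. R (t xs) xs)"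
proof -
  have "grz_class k (Suc n) (\<lambda>l. R (hd l) (tl l))"
    by (rule grz_class.bounded_rec[OF assms(1-3)]) (use assms(4-6) in auto)
  from grz_compose[OF this grz_list_Cons[OF assms(7) grz_list_id]] show ?thesis by simp
qed

text \<open>The recursion ignores its previous value and returns the counter, so the recursion
  argument itself is a bound.\<close>

lemma grz_pred: "grz_class k n f \<Longrightarrow> grz_class k n (\<lambda>xs. f xs - 1)"
proof (rule grz_lift1[where F = "\<lambda>x. x - 1"])
  show "grz_class k 1 (\<lambda>l. l ! 0 - 1)"
    by (rule grz_rec[where R = "\<lambda>y _. y - 1" and g = "\<lambda>_. 0" and u = "\<lambda>l. l ! 0"
          and b = "\<lambda>l. l ! 0"]) (auto intro: grz_const grz_nth)
qed

lemma grz_diff: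
  assumes "grz_class k n f" "grz_class k n g"
  shows "grz_class k n (\<lambda>xs. f xs - g xs)"
  using assms(2)
  by (rule grz_rec[where R = "\<lambda>y xs. f xs - y" and g = f and u = "\<lambda>l. l ! 1 - 1"
        and b = "\<lambda>l. f (tl l)", rotated -1])
    (simp_all add: assms(1) grz_tl grz_pred grz_nth del: One_nat_def)

text \<open>The square in \<open>grz_h 1\<close>, taken at the sum of the factors, bounds all
  partial products; this is where level 2 enters.\<close>

lemma grz_mult:
  assumes "2 \<le> k" "grz_class k n f" "grz_class k n g"
  shows "grz_class k n (\<lambda>xs. f xs * g xs)"
proof (rule grz_rec[where R = "\<lambda>y xs. y * g xs" and t = f and g = "\<lambda>_. 0"
      and u = "\<lambda>l. g (tl (tl l)) + l ! 1" and b = "\<lambda>l. grz_h 1 (l ! 0 + g (tl l))"])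
  fix y and xs :: "nat list"
  show "y * g xs \<le> grz_h 1 ((y # xs) ! 0 + g (tl (y # xs)))"
    by (simp add: power2_eq_square algebra_simps)
  show "grz_class k (Suc (Suc n)) (\<lambda>l. g (tl (tl l)) + l ! 1)"
    by (intro grz_add grz_tl[OF grz_tl[OF assms(3)]] grz_nth) simp
  show "grz_class k (Suc n) (\<lambda>l. grz_h 1 (l ! 0 + g (tl l)))"
    by (intro grz_grz_h grz_add grz_tl[OF assms(3)] grz_nth) (use assms(1) in simp_all)
qed (simp_all add: assms(2) grz_const)

lemma grz_if:
  assumes "2 \<le> k" "grz_class k n e" "grz_class k n f" "grz_class k n g"
  shows "grz_class k n (\<lambda>xs. if e xs = 0 then f xs else g xs)"
proof (rule grz_cong)
  \<comment> \<open>With truncated subtraction \<open>1 - e xs\<close> is the indicator of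
    \<open>e xs = 0\<close>.\<close>
  show "grz_class k n (\<lambda>xs. f xs * (1 - e xs) + g xs * (1 - (1 - e xs)))"
    by (intro grz_add grz_mult grz_diff grz_const assms)
qed auto

lemma grz_if_eq:
  assumes "2 \<le> k" "grz_class k n d" "grz_class k n e" "grz_class k n f" "grz_class k n g"
  shows "grz_class k n (\<lambda>xs. if d xs = e xs then f xs else g xs)"
proof (rule grz_cong)
  show "grz_class k n (\<lambda>xs. if (d xs - e xs) + (e xs - d xs) = 0 then f xs else g xs)"
    by (intro grz_if grz_add grz_diff assms)
qed auto

lemma grz_min:
  "grz_class k n f \<Longrightarrow> grz_class k n g \<Longrightarrow> grz_class k n (\<lambda>xs. min (f xs) (g xs))"
  by (rule grz_cong[where f = "\<lambda>xs. f xs - (f xs - g xs)"]) (auto intro: grz_diff)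

lemma grz_max:
  "grz_class k n f \<Longrightarrow> grz_class k n g \<Longrightarrow> grz_class k n (\<lambda>xs. max (f xs) (g xs))"
  by (rule grz_cong[where f = "\<lambda>xs. f xs + (g xs - f xs)"]) (auto intro: grz_diff grz_add)

lemma grz_sum:
  "(\<And>i::nat. i < m \<Longrightarrow> grz_class k n (e i)) \<Longrightarrow> grz_class k n (\<lambda>xs. \<Sum>i<m. e i xs)"
  by (induction m) (auto intro: grz_const grz_add)

lemma grz_sum_list:
  assumes "grz_list k n m E"
  shows "grz_class k n (\<lambda>xs. sum_list (E xs))"
proof (rule grz_cong)
  show "grz_class k n (\<lambda>xs. \<Sum>i<m. E xs ! i)"
    using assms by (intro grz_sum) (auto simp: grz_list_def)
  show "(\<Sum>i<m. E xs ! i) = sum_list (E xs)" if "length xs = n" for xs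
    using assms that by (simp add: grz_list_def sum_list_sum_nth atLeast0LessThan)
qed

text \<open>Truncating the recursion makes the required bound hold on all arguments, also on those that
  do not code anything.\<close>

primrec trunc_rec where
  "trunc_rec b g u 0 xs = min (g xs) (b xs)"
| "trunc_rec b g u (Suc y) xs = min (u (y # trunc_rec b g u y xs # xs)) (b xs)"

lemma grz_trunc_rec:
  fixes b g u :: "nat list \<Rightarrow> nat"
  assumes "grz_class k n b" "grz_class k n g" "grz_class k (Suc (Suc n)) u"
    and "grz_class k n' t" "grz_list k n' n E"
  shows "grz_class k n' (\<lambda>xs. trunc_rec b g u (t xs) (E xs))"
proof -
  have "grz_class k (Suc n) (\<lambda>l. trunc_rec b g u (hd l) (tl l))"
  proof (rule grz_class.bounded_rec)
    show "grz_class k n (\<lambda>xs. min (g xs) (b xs))"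
      by (intro grz_min assms)
    show "grz_class k (Suc (Suc n)) (\<lambda>l. min (u l) (b (tl (tl l))))"
      by (intro grz_min assms grz_tl[OF grz_tl[OF assms(1)]])
    show "grz_class k (Suc n) (\<lambda>l. b (tl l))"
      by (intro grz_tl[OF assms(1)])
    have "trunc_rec b g u y xs \<le> b xs" for y xs
      by (cases y) auto
    then show "\<forall>xs. length xs = n \<longrightarrow>
       trunc_rec b g u (hd (0 # xs)) (tl (0 # xs)) = min (g xs) (b xs) \<and>
       (\<forall>y. trunc_rec b g u (hd (Suc y # xs)) (tl (Suc y # xs)) =
            min (u (y # trunc_rec b g u (hd (y # xs)) (tl (y # xs)) # xs))
             (b (tl (tl (y # trunc_rec b g u (hd (y # xs)) (tl (y # xs)) # xs))))) \<and>
       (\<forall>y. trunc_rec b g u (hd (y # xs)) (tl (y # xs)) \<le> b (tl (y # xs)))"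
      by simp
  qed
  from grz_compose[OF this grz_list_Cons[OF assms(4,5)]] show ?thesis by simp
qed

subsection \<open>Growth\<close>

text \<open>One induction carries all three facts: comparing a function with the next one uses the
  linear lower bound and monotonicity at positive arguments, and the common value 2 at 0.\<close>

lemma grz_h_ge_and_mono: "2 * n + 1 \<le> grz_h (Suc j) n \<and> mono (grz_h (Suc j)) \<and> grz_h (Suc j) 0 = 2"
proof (induction j arbitrary: n)
  case 0
  have "2 * n \<le> n * n + 1"
  proof (cases n)
    case (Suc m) then show ?thesis by (simp add: algebra_simps)
  qed simp
  then show ?case by (auto simp: mono_def power2_eq_square intro: mult_mono)
next
  case (Suc j)
  let ?h = "grz_h (Suc j)"
  have ge: "2 * y + 1 \<le> ?h y" for y
    using Suc.IH by auto
  have mono: "mono ?h" and h0: "?h 0 = 2"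
    using Suc.IH by auto
  have it: "y + 2 \<le> (?h ^^ y) 2" for y
  proof (induction y)
    case (Suc y) then show ?case using ge[of "(?h ^^ y) 2"] by simp
  qed simp
  have "?h n \<le> grz_h (Suc (Suc j)) n"
  proof (cases n)
    case (Suc m)
    have "?h n \<le> ?h ((?h ^^ m) 2)"
      using it[of m] Suc by (intro monoD[OF mono]) auto
    then show ?thesis using Suc by simp
  qed (simp add: h0)
  moreover have "mono (grz_h (Suc (Suc j)))"
  proof (rule mono_iff_le_Suc[THEN iffD2], intro allI)
    fix y show "grz_h (Suc (Suc j)) y \<le> grz_h (Suc (Suc j)) (Suc y)"
      using ge[of "(?h ^^ y) 2"] by simp
  qed
  ultimately show ?case using ge[of n] by simp
qed

lemma grz_h_ge: "2 * n + 1 \<le> grz_h (Suc j) n"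
  and grz_h_mono: "mono (grz_h (Suc j))"
  and grz_h_0: "grz_h (Suc j) 0 = 2"
  using grz_h_ge_and_mono by auto

lemma funpow_inflationary:
  fixes f :: "nat \<Rightarrow> nat"
  assumes "\<And>x. x < f x"
  shows "x + m \<le> (f ^^ m) x"
  by (induction m) (auto intro: Suc_leI dest: order.strict_trans1[OF _ assms])

lemma funpow_mono_exponent:
  fixes f :: "nat \<Rightarrow> nat"
  assumes "\<And>x. x < f x" "m \<le> m'"
  shows "(f ^^ m) x \<le> (f ^^ m') x"
proof -
  obtain d where "m' = d + m" using assms(2) by (metis add.commute le_Suc_ex)
  then show ?thesis
    using funpow_inflationary[of f "(f ^^ m) x" d] assms(1) by (simp add: funpow_add)
qed

lemma grz_h_less: "n < grz_h (Suc j) n"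
  using grz_h_ge[of n j] by simp

lemma grz_h_le_Suc: "grz_h (Suc j) n \<le> grz_h (Suc (Suc j)) n"
proof (cases n)
  case (Suc m)
  have "n \<le> (grz_h (Suc j) ^^ m) 2"
    using funpow_inflationary[of "grz_h (Suc j)" 2 m] grz_h_less Suc by simp
  then show ?thesis using Suc monoD[OF grz_h_mono] by simp
qed (simp add: grz_h_0)

lemma grz_h_le: "i \<le> j \<Longrightarrow> grz_h (Suc i) n \<le> grz_h (Suc j) n"
  by (induction rule: dec_induct) (auto intro: order_trans grz_h_le_Suc simp del: grz_h.simps)

lemma grz_h_funpow_mono: "x \<le> y \<Longrightarrow> c \<le> d \<Longrightarrow> (grz_h (Suc j) ^^ c) x \<le> (grz_h (Suc j) ^^ d) y"
  using funpow_mono_exponent[of "grz_h (Suc j)" c d y] grz_h_less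
    funpow_mono[OF grz_h_mono, of x y c] by (auto intro: order_trans)

text \<open>Each application at least doubles, so \<open>c\<close> applications absorb a sum of
  \<open>c\<close> equal terms. This majorizes a composition with several inner functions.\<close>

lemma times_le_grz_h_funpow: "c * x \<le> (grz_h (Suc j) ^^ c) x"
proof (induction c)
  case (Suc c)
  have "2 * ((grz_h (Suc j) ^^ c) x) \<le> (grz_h (Suc j) ^^ Suc c) x"
    using grz_h_ge[of "(grz_h (Suc j) ^^ c) x" j] by simp
  moreover have "x \<le> (grz_h (Suc j) ^^ c) x"
    using grz_h_funpow_mono[of x x 0 c j] by simp
  ultimately show ?case using Suc by simp
qed simp

text \<open>Growth comes from the initial functions alone: compositions add up the numbers of
  iterations, and bounded recursion inherits the majorant of its bound.\<close>

lemma grz_majorant: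
  assumes "grz_class (Suc (Suc k)) n f"
  shows "\<exists>c. \<forall>xs. length xs = n \<longrightarrow> f xs \<le> (grz_h (Suc k) ^^ c) (sum_list xs)"
  using assms
proof induction
  case (zero f)
  then show ?case by (auto intro: exI[of _ 0])
next
  case (succ f)
  have "x + 1 \<le> (grz_h (Suc k) ^^ 1) x" for x
    using grz_h_less[of x k] by simp
  then show ?case using succ by (intro exI[of _ 1]) (auto simp: length_Suc_conv)
next
  case (proj i n f)
  then show ?case by (intro exI[of _ 0]) (auto simp: elem_le_sum_list)
next
  case (add f)
  then show ?case by (intro exI[of _ 0]) (auto simp: length_Suc_conv numeral_2_eq_2)
next
  case (h j f)
  then obtain i where "j = Suc i" "i \<le> k" by (cases j) auto
  then show ?case using h
    by (intro exI[of _ 1]) (auto simp: length_Suc_conv grz_h_le simp del: grz_h.simps)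
next
  case (comp gs u n f)
  from comp.IH obtain cu where
    cu: "\<And>xs. length xs = length gs \<Longrightarrow> u xs \<le> (grz_h (Suc k) ^^ cu) (sum_list xs)" by blast
  from comp.IH obtain cg where
    cg: "\<And>g xs. g \<in> set gs \<Longrightarrow> length xs = n \<Longrightarrow> g xs \<le> (grz_h (Suc k) ^^ cg g) (sum_list xs)"
    by metis
  define c where "c = sum_list (map cg gs)"
  show ?case
  proof (intro exI allI impI)
    fix xs :: "nat list" assume l: "length xs = n"
    let ?y = "(grz_h (Suc k) ^^ c) (sum_list xs)"
    have "g xs \<le> ?y" if "g \<in> set gs" for g
    proof -
      have "cg g \<le> c" using that unfolding c_def by (intro member_le_sum_list) auto
      then show ?thesis
        using cg[OF that l] grz_h_funpow_mono[of "sum_list xs" "sum_list xs" "cg g" c k] by simp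
    qed
    then have "sum_list (map (\<lambda>g. g xs) gs) \<le> sum_list (map (\<lambda>_. ?y) gs)"
      by (intro sum_list_mono) auto
    also have "\<dots> = length gs * ?y" by (simp add: sum_list_triv)
    also have "\<dots> \<le> (grz_h (Suc k) ^^ length gs) ?y" by (rule times_le_grz_h_funpow)
    finally have "(grz_h (Suc k) ^^ cu) (sum_list (map (\<lambda>g. g xs) gs))
        \<le> (grz_h (Suc k) ^^ cu) ((grz_h (Suc k) ^^ length gs) ?y)"
      by (intro grz_h_funpow_mono) auto
    moreover have "f xs \<le> (grz_h (Suc k) ^^ cu) (sum_list (map (\<lambda>g. g xs) gs))"
      using comp.hyps l cu[of "map (\<lambda>g. g xs) gs"] by simp
    ultimately show "f xs \<le> (grz_h (Suc k) ^^ (cu + (length gs + c))) (sum_list xs)"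
      by (simp add: funpow_add)
  qed
next
  case (bounded_rec n g u b f)
  then show ?case by (metis (no_types, lifting) Suc_length_conv order_trans)
qed

lemma grz_funpow_const:
  "grz_class k 1 (\<lambda>l. F (l ! 0)) \<Longrightarrow> grz_class k n f \<Longrightarrow> grz_class k n (\<lambda>xs. (F ^^ c) (f xs))"
  by (induction c) (simp_all add: grz_lift1[where F = F])

text \<open>A bound extracted from a simulation is not known to be monotone in the codes, while one
  value has to serve for all codes of a descent. A monotone unary majorant inside the class supplies
  it.\<close>

lemma grz_mono_majorant:
  assumes "grz_class (Suc (Suc k)) n f"
  obtains b where "mono b" "grz_class (Suc (Suc k)) 1 (\<lambda>l. b (l ! 0))"
    "\<And>xs. length xs = n \<Longrightarrow> f xs \<le> b (sum_list xs)"
proof -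
  obtain c where c: "\<forall>xs. length xs = n \<longrightarrow> f xs \<le> (grz_h (Suc k) ^^ c) (sum_list xs)"
    using grz_majorant[OF assms] by blast
  show thesis
  proof (rule that[of "grz_h (Suc k) ^^ c"])
    show "mono (grz_h (Suc k) ^^ c)" by (auto simp: mono_def intro: grz_h_funpow_mono)
    show "grz_class (Suc (Suc k)) 1 (\<lambda>l. (grz_h (Suc k) ^^ c) (l ! 0))"
      by (intro grz_funpow_const grz_grz_h grz_nth) auto
  qed (use c in auto)
qed

text \<open>Iteration with a computed number of rounds costs exactly one level: an iterate of
  \<open>grz_h (Suc k)\<close> started at 2 is a value of the next function, with the number of
  rounds as its argument.\<close>

lemma grz_funpow:
  assumes f: "grz_class (Suc (Suc k)) (Suc n) (\<lambda>l. f (l ! 0) (tl l))"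
    and s: "grz_class (Suc (Suc (Suc k))) n s" and r: "grz_class (Suc (Suc (Suc k))) n r"
  shows "grz_class (Suc (Suc (Suc k))) n (\<lambda>xs. ((\<lambda>u. f u xs) ^^ r xs) (s xs))"
proof -
  let ?K = "Suc (Suc (Suc k))" and ?h = "grz_h (Suc k)"
  obtain c where c: "\<And>u xs. length xs = n \<Longrightarrow> f u xs \<le> (?h ^^ c) (u + sum_list xs)"
    using grz_majorant[OF f] by (metis length_Cons list.sel(3) nth_Cons_0 sum_list.Cons)
  \<comment> \<open>The parameters enter the majorant again in every round, so their sum is carried
    along; the extra application in \<open>Suc c\<close> absorbs it by doubling.\<close>
  have bound: "((\<lambda>u. f u xs) ^^ y) (s xs) + sum_list xs
      \<le> (?h ^^ (Suc c * y)) (s xs + sum_list xs)" if "length xs = n" for y xs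
  proof (induction y)
    case (Suc y)
    let ?I = "((\<lambda>u. f u xs) ^^ y) (s xs)" and ?v = "(?h ^^ (Suc c * y)) (s xs + sum_list xs)"
    have "f ?I xs \<le> (?h ^^ c) (?I + sum_list xs)" using c that by blast
    also have "\<dots> \<le> (?h ^^ c) ?v" by (intro grz_h_funpow_mono Suc.IH order_refl)
    finally have "f ?I xs \<le> (?h ^^ c) ?v" .
    moreover have "sum_list xs \<le> (?h ^^ c) ?v"
      using Suc.IH grz_h_funpow_mono[of ?v ?v 0 c k] by simp
    moreover have "2 * (?h ^^ c) ?v \<le> (?h ^^ Suc c) ?v"
      using grz_h_ge[of "(?h ^^ c) ?v" k] by simp
    ultimately have "f ?I xs + sum_list xs \<le> (?h ^^ Suc c) ?v" by linarith
    also have "\<dots> = (?h ^^ (Suc c * Suc y)) (s xs + sum_list xs)"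
      unfolding mult_Suc_right funpow_add by simp
    finally show ?case by simp
  qed simp
  show ?thesis
    using r
  proof (rule grz_rec[where R = "\<lambda>y xs. ((\<lambda>u. f u xs) ^^ y) (s xs)" and g = s
        and u = "\<lambda>l. f (l ! 1) (tl (tl l))"
        and b = "\<lambda>l. grz_h (Suc (Suc k)) (Suc c * (l ! 0) + (s (tl l) + sum_list (tl l)))",
        rotated -1])
    have "grz_class ?K (Suc (Suc n)) (\<lambda>l. (\<lambda>l. f (l ! 0) (tl l)) (tl l))"
      by (rule grz_tl, rule grz_mono[OF f]) simp
    then show "grz_class ?K (Suc (Suc n)) (\<lambda>l. f (l ! 1) (tl (tl l)))"
      by (rule grz_cong) (auto simp: nth_tl)
    show "grz_class ?K (Suc n)
        (\<lambda>l. grz_h (Suc (Suc k)) (Suc c * (l ! 0) + (s (tl l) + sum_list (tl l))))"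
      by (intro grz_grz_h grz_add grz_mult grz_const grz_nth grz_tl[OF s]
          grz_tl[OF grz_sum_list[OF grz_list_id]]) auto
    fix xs :: "nat list" and y assume l: "length xs = n"
    let ?z = "s xs + sum_list xs"
    have "((\<lambda>u. f u xs) ^^ y) (s xs) \<le> (?h ^^ (Suc c * y)) ?z"
      using bound[OF l, of y] by simp
    \<comment> \<open>The start value is traded for further rounds: \<open>?z\<close> applications
      to 2 already exceed \<open>?z\<close>.\<close>
    also have "\<dots> \<le> (?h ^^ (Suc c * y)) ((?h ^^ ?z) 2)"
      using funpow_inflationary[of ?h 2 ?z] grz_h_less
      by (intro grz_h_funpow_mono order_refl) (auto intro: order_trans[rotated])
    also have "\<dots> = grz_h (Suc (Suc k)) (Suc c * y + ?z)" by (simp add: funpow_add)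
    finally show "((\<lambda>u. f u xs) ^^ y) (s xs) \<le> grz_h (Suc (Suc k))
        (Suc c * ((y # xs) ! 0) + (s (tl (y # xs)) + sum_list (tl (y # xs))))"
      by simp
  qed (use s in auto)
qed

subsection \<open>Pairing\<close>

primrec isqrt :: "nat \<Rightarrow> nat" where
  "isqrt 0 = 0"
| "isqrt (Suc n) = (if Suc (isqrt n) * Suc (isqrt n) = Suc n then Suc (isqrt n) else isqrt n)"

text \<open>The value lies between the squares of a + b and a + b + 1, so an integer square root
  recovers a + b and subtraction does the rest. Pairing and projections are thus available at level
  2.\<close>

definition npair :: "nat \<Rightarrow> nat \<Rightarrow> nat" where "npair a b = (a + b) * (a + b) + a"
definition nfst :: "nat \<Rightarrow> nat" where "nfst z = z - isqrt z * isqrt z"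
definition nsnd :: "nat \<Rightarrow> nat" where "nsnd z = isqrt z - nfst z"

lemma isqrt_bounds: "isqrt n * isqrt n \<le> n \<and> n < Suc (isqrt n) * Suc (isqrt n)"
  by (induction n) auto

lemma isqrt_npair: "isqrt (npair a b) = a + b"
proof -
  let ?z = "npair a b"
  have "\<not> isqrt ?z < a + b"
  proof
    assume "isqrt ?z < a + b"
    then have "Suc (isqrt ?z) * Suc (isqrt ?z) \<le> (a + b) * (a + b)" by (intro mult_le_mono) auto
    then show False using isqrt_bounds[of ?z] by (simp add: npair_def)
  qed
  moreover have "\<not> a + b < isqrt ?z"
  proof
    assume "a + b < isqrt ?z"
    then have "Suc (a + b) * Suc (a + b) \<le> isqrt ?z * isqrt ?z" by (intro mult_le_mono) auto
    also have "\<dots> \<le> (a + b) * (a + b) + a" using isqrt_bounds[of ?z] by (simp add: npair_def)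
    finally show False by (simp add: algebra_simps)
  qed
  ultimately show ?thesis by simp
qed

lemma nfst_npair [simp]: "nfst (npair a b) = a"
  unfolding nfst_def isqrt_npair by (simp add: npair_def)

lemma nsnd_npair [simp]: "nsnd (npair a b) = b"
  by (simp add: nsnd_def isqrt_npair)

lemma npair_mono: "a \<le> a' \<Longrightarrow> b \<le> b' \<Longrightarrow> npair a b \<le> npair a' b'"
  unfolding npair_def by (intro add_mono mult_le_mono) auto

lemma npair_ge: "a \<le> npair a b" "b \<le> npair a b"
  unfolding npair_def using le_square[of "a + b"] by linarith+

lemma grz_npair:
  "2 \<le> k \<Longrightarrow> grz_class k n f \<Longrightarrow> grz_class k n g \<Longrightarrow> grz_class k n (\<lambda>xs. npair (f xs) (g xs))"
  unfolding npair_def by (intro grz_add grz_mult) auto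

lemma grz_isqrt:
  assumes "2 \<le> k" "grz_class k n f"
  shows "grz_class k n (\<lambda>xs. isqrt (f xs))"
  using assms(2)
proof (rule grz_rec[where R = "\<lambda>y _. isqrt y" and g = "\<lambda>_. 0" and b = "\<lambda>l. l ! 0"
      and u = "\<lambda>l. if Suc (l ! 1) * Suc (l ! 1) = Suc (l ! 0) then Suc (l ! 1) else l ! 1",
      rotated -1])
  fix y and xs :: "nat list"
  show "isqrt y \<le> (y # xs) ! 0" by (induction y) auto
  show "grz_class k (Suc (Suc n))
      (\<lambda>l. if Suc (l ! 1) * Suc (l ! 1) = Suc (l ! 0) then Suc (l ! 1) else l ! 1)"
    by (intro grz_if_eq grz_mult grz_Suc grz_nth) (use assms(1) in simp_all)
qed (simp_all add: grz_const grz_nth)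

lemma grz_nfst: "2 \<le> k \<Longrightarrow> grz_class k n f \<Longrightarrow> grz_class k n (\<lambda>xs. nfst (f xs))"
  unfolding nfst_def by (intro grz_diff grz_mult grz_isqrt) auto

lemma grz_nsnd: "2 \<le> k \<Longrightarrow> grz_class k n f \<Longrightarrow> grz_class k n (\<lambda>xs. nsnd (f xs))"
  unfolding nsnd_def by (intro grz_diff grz_isqrt grz_nfst) auto

section \<open>Simulation on codes of ordinals\<close>

text \<open>Kinds 0, 1, 2 mean zero, successor and limit; larger kinds mark silent steps that keep
  the value. \<open>nx c x\<close> makes one step with limits resolved at \<open>x\<close>, and
  \<open>V\<close> is closed under steps at any index. The rank \<open>r\<close> proves termination
  at a fixed index. \<open>L\<close> and \<open>M\<close> are computable bounds for the number of
  steps and for the codes met; \<open>M_nx\<close> lets the bound at the start hold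
  throughout.\<close>

locale code_system =
  fixes k :: nat and V :: "nat set" and val :: "nat \<Rightarrow> cord"
    and kd :: "nat \<Rightarrow> nat" and nx L M r :: "nat \<Rightarrow> nat \<Rightarrow> nat"
  assumes grz_kd: "grz_class (Suc (Suc k)) 1 (\<lambda>l. kd (l ! 0))"
    and grz_nx: "grz_class (Suc (Suc k)) 2 (\<lambda>l. nx (l ! 0) (l ! 1))"
    and grz_L: "grz_class (Suc (Suc k)) 2 (\<lambda>l. L (l ! 0) (l ! 1))"
    and grz_M: "grz_class (Suc (Suc k)) 2 (\<lambda>l. M (l ! 0) (l ! 1))"
    and nx_V: "c \<in> V \<Longrightarrow> nx c x \<in> V"
    and val_zero: "c \<in> V \<Longrightarrow> kd c = 0 \<Longrightarrow> val c = OZero"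
    and nx_zero: "c \<in> V \<Longrightarrow> kd c = 0 \<Longrightarrow> nx c x = c"
    and val_suc: "c \<in> V \<Longrightarrow> kd c = 1 \<Longrightarrow> val c = OSuc (val (nx c x))"
    and val_lim: "c \<in> V \<Longrightarrow> kd c = 2 \<Longrightarrow> val c = OLim (\<lambda>x. val (nx c x))"
    and val_silent: "c \<in> V \<Longrightarrow> 2 < kd c \<Longrightarrow> val (nx c x) = val c"
    and rank_less: "c \<in> V \<Longrightarrow> kd c \<noteq> 0 \<Longrightarrow> r (nx c x) x < r c x"
    and rank_le: "c \<in> V \<Longrightarrow> r c x \<le> L c x"
    and code_le: "c \<in> V \<Longrightarrow> c \<le> M c x"
    and M_nx: "c \<in> V \<Longrightarrow> M (nx c x) x \<le> M c x"

definition code_args ::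
    "nat set \<Rightarrow> (nat \<Rightarrow> cord) \<Rightarrow> cord set \<Rightarrow> nat \<Rightarrow> nat \<Rightarrow> nat \<Rightarrow>
     nat list \<Rightarrow> nat list \<Rightarrow> nat list \<Rightarrow> bool" where
  "code_args V val A p m q cs ns as \<longleftrightarrow> length cs = p \<and> set cs \<subseteq> V \<and> val ` set cs \<subseteq> A \<and>
     length ns = m \<and> length as = q"

text \<open>The bound \<open>b\<close> sees only codes and normal arguments. Quantifying over all
  upper bounds \<open>z\<close> of the safe arguments replaces their maximum and covers the empty
  list.\<close>

definition simulable ::
    "nat \<Rightarrow> nat set \<Rightarrow> (nat \<Rightarrow> cord) \<Rightarrow> cord set \<Rightarrow> nat \<Rightarrow> nat \<Rightarrow> nat \<Rightarrow>
     (cord list \<Rightarrow> nat list \<Rightarrow> nat list \<Rightarrow> nat) \<Rightarrow> bool" where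
  "simulable k V val A p m q f \<longleftrightarrow> (\<exists>F b.
     grz_class (Suc (Suc k)) (p + m + q) F \<and> grz_class (Suc (Suc k)) (p + m) b \<and>
     (\<forall>cs ns as. code_args V val A p m q cs ns as \<longrightarrow>
        F (cs @ ns @ as) = f (map val cs) ns as \<and>
        (\<forall>z. (\<forall>a\<in>set as. a \<le> z) \<longrightarrow> f (map val cs) ns as \<le> b (cs @ ns) + z)))"

lemma simulableI:
  assumes "grz_class (Suc (Suc k)) (p + m + q) F" "grz_class (Suc (Suc k)) (p + m) b"
    and "\<And>cs ns as. code_args V val A p m q cs ns as \<Longrightarrow> F (cs @ ns @ as) = f (map val cs) ns as"
    and "\<And>cs ns as z. code_args V val A p m q cs ns as \<Longrightarrow> (\<And>a. a \<in> set as \<Longrightarrow> a \<le> z) \<Longrightarrow>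
      f (map val cs) ns as \<le> b (cs @ ns) + z"
  shows "simulable k V val A p m q f"
  unfolding simulable_def using assms by blast

lemma simulableE:
  assumes "simulable k V val A p m q f"
  obtains F b where
    "grz_class (Suc (Suc k)) (p + m + q) F" "grz_class (Suc (Suc k)) (p + m) b"
    "\<And>cs ns as. code_args V val A p m q cs ns as \<Longrightarrow> F (cs @ ns @ as) = f (map val cs) ns as"
    "\<And>cs ns as z. code_args V val A p m q cs ns as \<Longrightarrow> (\<And>a. a \<in> set as \<Longrightarrow> a \<le> z) \<Longrightarrow>
      f (map val cs) ns as \<le> b (cs @ ns) + z"
  using assms unfolding simulable_def by blast

section \<open>Simulation of the initial functions and of the rules other than recursion\<close>

lemma code_args_args:
  "code_args V val A p m q cs ns as \<Longrightarrow> (map val cs, ns, as) \<in> args A p m q"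
  by (auto simp: code_args_def args_def)

lemma simulable_zero:
  assumes "f [] [] [] = 0"
  shows "simulable k V val A 0 0 0 f"
  by (rule simulableI[where F = "\<lambda>_. 0" and b = "\<lambda>_. 0"])
    (use assms in \<open>auto intro: grz_const simp: code_args_def\<close>)

lemma simulable_proj_normal:
  assumes "i < m" "\<forall>(\<mu>s, ns, as) \<in> args A p m q. f \<mu>s ns as = ns ! i"
  shows "simulable k V val A p m q f"
proof -
  have f: "f (map val cs) ns as = ns ! i" if "code_args V val A p m q cs ns as" for cs ns as
    using assms(2) code_args_args[OF that] by auto
  show ?thesis
    by (rule simulableI[where F = "\<lambda>xs. xs ! (p + i)" and b = "\<lambda>xs. xs ! (p + i)"])
      (use assms(1) f in \<open>auto intro!: grz_nth simp: code_args_def nth_append\<close>)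
qed

lemma simulable_proj_safe:
  assumes "j < q" "\<forall>(\<mu>s, ns, as) \<in> args A p m q. f \<mu>s ns as = as ! j"
  shows "simulable k V val A p m q f"
proof -
  have f: "f (map val cs) ns as = as ! j" if "code_args V val A p m q cs ns as" for cs ns as
    using assms(2) code_args_args[OF that] by auto
  show ?thesis
    by (rule simulableI[where F = "\<lambda>xs. xs ! (p + (m + j))" and b = "\<lambda>xs. 0"])
      (use assms(1) f in \<open>auto intro!: grz_nth grz_const simp: code_args_def nth_append\<close>)
qed

lemma simulable_succ:
  assumes "\<forall>a. f [] [] [a] = a + 1"
  shows "simulable k V val A 0 0 1 f"
proof (rule simulableI[where F = "\<lambda>xs. Suc (xs ! 0)" and b = "\<lambda>_. 1"])
  show "grz_class (Suc (Suc k)) (0 + 0 + 1) (\<lambda>xs. Suc (xs ! 0))"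
    by (intro grz_Suc grz_nth) simp
qed (use assms in \<open>auto simp: code_args_def length_Suc_conv grz_const\<close>)

lemma simulable_pred:
  assumes "f [] [] [0] = 0" "\<forall>a. f [] [] [a + 1] = a"
  shows "simulable k V val A 0 0 1 f"
proof (rule simulableI[where F = "\<lambda>xs. xs ! 0 - 1" and b = "\<lambda>_. 0"])
  show "grz_class (Suc (Suc k)) (0 + 0 + 1) (\<lambda>xs. xs ! 0 - 1)"
    by (intro grz_pred grz_nth) simp
  have f: "f [] [] [a] = a - 1" for a using assms by (cases a) auto
  fix cs ns as assume "code_args V val A 0 0 1 cs ns as"
  then obtain a where a: "cs = []" "ns = []" "as = [a]"
    by (auto simp: code_args_def length_Suc_conv)
  then show "(cs @ ns @ as) ! 0 - 1 = f (map val cs) ns as" using f by simp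
  fix z assume "\<And>a. a \<in> set as \<Longrightarrow> a \<le> z"
  then have "a \<le> z" using a by simp
  then show "f (map val cs) ns as \<le> 0 + z" using f a by simp
qed (rule grz_const)

lemma simulable_cond:
  assumes "\<forall>a b c. f [] [] [a, b, c] = (if a = 0 then b else c)"
  shows "simulable k V val A 0 0 3 f"
proof (rule simulableI[where F = "\<lambda>xs. if xs ! 0 = 0 then xs ! 1 else xs ! 2" and b = "\<lambda>_. 0"])
  show "grz_class (Suc (Suc k)) (0 + 0 + 3) (\<lambda>xs. if xs ! 0 = 0 then xs ! 1 else xs ! 2)"
    by (intro grz_if grz_nth) auto
qed (use assms in \<open>auto simp: code_args_def length_Suc_conv numeral_3_eq_3 grz_const\<close>)

lemma simulable_exchange:
  assumes "simulable k V val A p m q g" and ij: "i < p" "j < p"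
    and f: "\<forall>(\<mu>s, ns, as) \<in> args A p m q. f \<mu>s ns as = g (\<mu>s[i := \<mu>s ! j, j := \<mu>s ! i]) ns as"
  shows "simulable k V val A p m q f"
proof -
  from assms(1) obtain F b where F: "grz_class (Suc (Suc k)) (p + m + q) F"
    and b: "grz_class (Suc (Suc k)) (p + m) b"
    and Fg: "\<And>cs ns as. code_args V val A p m q cs ns as \<Longrightarrow> F (cs @ ns @ as) = g (map val cs) ns as"
    and bg: "\<And>cs ns as z. code_args V val A p m q cs ns as \<Longrightarrow> (\<And>a. a \<in> set as \<Longrightarrow> a \<le> z) \<Longrightarrow>
      g (map val cs) ns as \<le> b (cs @ ns) + z"
    by (rule simulableE) blast
  let ?sw = "\<lambda>xs :: nat list. xs[i := xs ! j, j := xs ! i]"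
  have sw: "code_args V val A p m q (?sw cs) ns as \<and> ?sw (cs @ ns @ as) = ?sw cs @ ns @ as \<and>
      ?sw (cs @ ns) = ?sw cs @ ns \<and> f (map val cs) ns as = g (map val (?sw cs)) ns as"
    if *: "code_args V val A p m q cs ns as" for cs ns as
  proof -
    have l: "length cs = p" using * by (simp add: code_args_def)
    have "set (?sw cs) = set cs" using ij l by (simp add: set_swap)
    moreover have "f (map val cs) ns as = g (map val (?sw cs)) ns as"
      using f code_args_args[OF *] ij l by (auto simp: map_update)
    ultimately show ?thesis
      using * ij l by (simp add: code_args_def list_update_append nth_append)
  qed
  show ?thesis
  proof (rule simulableI)
    show "grz_class (Suc (Suc k)) (p + m + q) (\<lambda>xs. F (?sw xs))"
      by (rule grz_compose[OF F grz_list_swap]) (use ij in auto)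
    show "grz_class (Suc (Suc k)) (p + m) (\<lambda>xs. b (?sw xs))"
      by (rule grz_compose[OF b grz_list_swap]) (use ij in auto)
  qed (use sw Fg bg in simp_all)
qed

lemma simulable_weakening:
  assumes "simulable k V val A p m q g"
    and f: "\<forall>(\<mu>s, ns, as) \<in> args A (Suc p) m q. f \<mu>s ns as = g (tl \<mu>s) ns as"
  shows "simulable k V val A (Suc p) m q f"
proof -
  from assms(1) obtain F b where F: "grz_class (Suc (Suc k)) (p + m + q) F"
    and b: "grz_class (Suc (Suc k)) (p + m) b"
    and Fg: "\<And>cs ns as. code_args V val A p m q cs ns as \<Longrightarrow> F (cs @ ns @ as) = g (map val cs) ns as"
    and bg: "\<And>cs ns as z. code_args V val A p m q cs ns as \<Longrightarrow> (\<And>a. a \<in> set as \<Longrightarrow> a \<le> z) \<Longrightarrow>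
      g (map val cs) ns as \<le> b (cs @ ns) + z"
    by (rule simulableE) blast
  have tl: "\<exists>c cs'. cs = c # cs' \<and> code_args V val A p m q cs' ns as \<and>
      f (map val cs) ns as = g (map val cs') ns as"
    if *: "code_args V val A (Suc p) m q cs ns as" for cs ns as
  proof -
    obtain c cs' where "cs = c # cs'" using * by (cases cs) (auto simp: code_args_def)
    then show ?thesis using * f code_args_args[OF *] by (auto simp: code_args_def)
  qed
  show ?thesis
  proof (rule simulableI)
    show "grz_class (Suc (Suc k)) (Suc p + m + q) (\<lambda>xs. F (tl xs))"
      using grz_tl[OF F] by simp
    show "grz_class (Suc (Suc k)) (Suc p + m) (\<lambda>xs. b (tl xs))"
      using grz_tl[OF b] by simp
  next
    fix cs ns as assume "code_args V val A (Suc p) m q cs ns as"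
    then obtain c cs' where cs: "cs = c # cs'" and *: "code_args V val A p m q cs' ns as"
      and fg: "f (map val cs) ns as = g (map val cs') ns as"
      using tl by blast
    show "F (tl (cs @ ns @ as)) = f (map val cs) ns as"
      using Fg[OF *] cs fg by simp
    fix z assume "\<And>a. a \<in> set as \<Longrightarrow> a \<le> z"
    then show "f (map val cs) ns as \<le> b (tl (cs @ ns)) + z"
      using bg[OF *] cs fg by simp
  qed
qed

lemma simulable_contraction:
  assumes "simulable k V val A (Suc (Suc p)) m q g"
    and f: "\<forall>(\<mu>s, ns, as) \<in> args A (Suc p) m q. f \<mu>s ns as = g (hd \<mu>s # \<mu>s) ns as"
  shows "simulable k V val A (Suc p) m q f"
proof -
  from assms(1) obtain F b where F: "grz_class (Suc (Suc k)) (Suc (Suc p) + m + q) F"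
    and b: "grz_class (Suc (Suc k)) (Suc (Suc p) + m) b"
    and Fg: "\<And>cs ns as. code_args V val A (Suc (Suc p)) m q cs ns as \<Longrightarrow>
      F (cs @ ns @ as) = g (map val cs) ns as"
    and bg: "\<And>cs ns as z. code_args V val A (Suc (Suc p)) m q cs ns as \<Longrightarrow>
      (\<And>a. a \<in> set as \<Longrightarrow> a \<le> z) \<Longrightarrow> g (map val cs) ns as \<le> b (cs @ ns) + z"
    by (rule simulableE) blast
  have dup: "code_args V val A (Suc (Suc p)) m q (cs ! 0 # cs) ns as \<and>
      (cs @ zs) ! 0 # cs @ zs = (cs ! 0 # cs) @ zs \<and>
      f (map val cs) ns as = g (map val (cs ! 0 # cs)) ns as"
    if *: "code_args V val A (Suc p) m q cs ns as" for cs ns as zs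
  proof -
    obtain c cs' where "cs = c # cs'" using * by (cases cs) (auto simp: code_args_def)
    then show ?thesis using * f code_args_args[OF *] by (auto simp: code_args_def)
  qed
  have gl: "grz_list (Suc (Suc k)) (Suc n) (Suc (Suc n)) (\<lambda>xs. xs ! 0 # xs)" for n
    by (intro grz_list_Cons grz_nth grz_list_id) simp
  show ?thesis
  proof (rule simulableI)
    show "grz_class (Suc (Suc k)) (Suc p + m + q) (\<lambda>xs. F (xs ! 0 # xs))"
      using grz_compose[OF F, of "Suc p + m + q" "\<lambda>xs. xs ! 0 # xs"] gl by simp
    show "grz_class (Suc (Suc k)) (Suc p + m) (\<lambda>xs. b (xs ! 0 # xs))"
      using grz_compose[OF b, of "Suc p + m" "\<lambda>xs. xs ! 0 # xs"] gl by simp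
  next
    fix cs ns as assume *: "code_args V val A (Suc p) m q cs ns as"
    show "F ((cs @ ns @ as) ! 0 # cs @ ns @ as) = f (map val cs) ns as"
      using dup[OF *, of "ns @ as"] Fg[of "cs ! 0 # cs" ns as] by simp
    fix z assume "\<And>a. a \<in> set as \<Longrightarrow> a \<le> z"
    then show "f (map val cs) ns as \<le> b ((cs @ ns) ! 0 # cs @ ns) + z"
      using dup[OF *, of ns] bg[of "cs ! 0 # cs" ns as z] by simp
  qed
qed

lemma simulable_subst_const:
  assumes "simulable k V val A (Suc p) m q g" and \<alpha>: "c \<in> V" "val c \<in> A" and i: "i \<le> p"
    and f: "\<forall>(\<mu>s, ns, as) \<in> args A p m q. f \<mu>s ns as = g (take i \<mu>s @ val c # drop i \<mu>s) ns as"
  shows "simulable k V val A p m q f"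
proof -
  from assms(1) obtain F b where F: "grz_class (Suc (Suc k)) (Suc p + m + q) F"
    and b: "grz_class (Suc (Suc k)) (Suc p + m) b"
    and Fg: "\<And>cs ns as. code_args V val A (Suc p) m q cs ns as \<Longrightarrow>
      F (cs @ ns @ as) = g (map val cs) ns as"
    and bg: "\<And>cs ns as z. code_args V val A (Suc p) m q cs ns as \<Longrightarrow>
      (\<And>a. a \<in> set as \<Longrightarrow> a \<le> z) \<Longrightarrow> g (map val cs) ns as \<le> b (cs @ ns) + z"
    by (rule simulableE) blast
  let ?E = "\<lambda>xs. take i xs @ c # drop i xs"
  have E: "code_args V val A (Suc p) m q (?E cs) ns as \<and> ?E (cs @ zs) = ?E cs @ zs \<and>
      f (map val cs) ns as = g (map val (?E cs)) ns as"
    if *: "code_args V val A p m q cs ns as" for cs ns as zs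
  proof -
    have "f (map val cs) ns as = g (map val (?E cs)) ns as"
      using f code_args_args[OF *] by (auto simp: take_map drop_map)
    moreover have "set (?E cs) \<subseteq> insert c (set cs)"
      by (auto dest: in_set_takeD in_set_dropD)
    then have "set (?E cs) \<subseteq> V" "val ` set (?E cs) \<subseteq> A"
      using * \<alpha> unfolding code_args_def by blast+
    ultimately show ?thesis
      using * i by (simp add: code_args_def)
  qed
  have gl: "grz_list (Suc (Suc k)) (p + n) (Suc (p + n)) ?E" for n
  proof -
    have "grz_list (Suc (Suc k)) (p + n) (i + Suc (p + n - i)) ?E"
      by (intro grz_list_append grz_list_take[OF grz_list_id] grz_list_Cons grz_const
          grz_list_drop[OF grz_list_id]) (use i in auto)
    then show ?thesis using i by simp
  qed
  show ?thesis
  proof (rule simulableI)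
    show "grz_class (Suc (Suc k)) (p + m + q) (\<lambda>xs. F (?E xs))"
      using grz_compose[OF F, of "p + m + q" ?E] gl[of "m + q"] by (simp add: add.assoc)
    show "grz_class (Suc (Suc k)) (p + m) (\<lambda>xs. b (?E xs))"
      using grz_compose[OF b, of "p + m" ?E] gl[of m] by simp
  next
    fix cs ns as assume *: "code_args V val A p m q cs ns as"
    show "F (?E (cs @ ns @ as)) = f (map val cs) ns as"
      using E[OF *, of "ns @ as"] Fg[of "?E cs" ns as] by simp
    fix z assume "\<And>a. a \<in> set as \<Longrightarrow> a \<le> z"
    then show "f (map val cs) ns as \<le> b (?E (cs @ ns)) + z"
      using E[OF *, of ns] bg[of "?E cs" ns as z] by simp
  qed
qed

text \<open>Substitution into the bound of \<open>h\<close> concerns only its normal places, whose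
  values do not depend on safe arguments; the functions \<open>ts\<close> enter additively, the sum
  of their bounds standing for the maximum. The separation of normal and safe arguments is what
  keeps the form b + z.\<close>

lemma simulable_safe_comp:
  assumes "simulable k V val A p (length ss) (length ts) h"
    and ss: "\<forall>s \<in> set ss. simulable k V val A p m 0 s"
    and ts: "\<forall>t \<in> set ts. simulable k V val A p m q t"
    and f: "\<forall>(\<mu>s, ns, as) \<in> args A p m q.
       f \<mu>s ns as = h \<mu>s (map (\<lambda>s. s \<mu>s ns []) ss) (map (\<lambda>t. t \<mu>s ns as) ts)"
  shows "simulable k V val A p m q f"
proof -
  let ?K = "Suc (Suc k)"
  from assms(1) obtain F b where F: "grz_class ?K (p + length ss + length ts) F"
    and b: "grz_class ?K (p + length ss) b"
    and Fg: "\<And>cs ns as. code_args V val A p (length ss) (length ts) cs ns as \<Longrightarrow>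
      F (cs @ ns @ as) = h (map val cs) ns as"
    and bg: "\<And>cs ns as z. code_args V val A p (length ss) (length ts) cs ns as \<Longrightarrow>
      (\<And>a. a \<in> set as \<Longrightarrow> a \<le> z) \<Longrightarrow> h (map val cs) ns as \<le> b (cs @ ns) + z"
    by (rule simulableE) blast
  have "\<forall>s \<in> set ss. \<exists>F. grz_class ?K (p + m) F \<and>
      (\<forall>cs ns as. code_args V val A p m 0 cs ns as \<longrightarrow> F (cs @ ns) = s (map val cs) ns [])"
  proof
    fix s assume "s \<in> set ss"
    with ss have "simulable k V val A p m 0 s" by blast
    then obtain F b where F: "grz_class ?K (p + m + 0) F"
      and Fs: "\<And>cs ns as. code_args V val A p m 0 cs ns as \<Longrightarrow> F (cs @ ns @ as) = s (map val cs) ns as"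
      by (rule simulableE) blast
    have "F (cs @ ns) = s (map val cs) ns []" if "code_args V val A p m 0 cs ns as" for cs ns as
      using Fs[of cs ns "[]"] that by (simp add: code_args_def)
    then show "\<exists>F. grz_class ?K (p + m) F \<and>
      (\<forall>cs ns as. code_args V val A p m 0 cs ns as \<longrightarrow> F (cs @ ns) = s (map val cs) ns [])"
      using F by auto
  qed
  from bchoice[OF this] obtain FS where FS: "\<And>s. s \<in> set ss \<Longrightarrow> grz_class ?K (p + m) (FS s)"
    "\<And>s cs ns as. s \<in> set ss \<Longrightarrow> code_args V val A p m 0 cs ns as \<Longrightarrow>
        FS s (cs @ ns) = s (map val cs) ns []"
    by blast
  from bchoice[OF ts[unfolded simulable_def]] obtain FT where "\<forall>t \<in> set ts. \<exists>b.
     grz_class ?K (p + m + q) (FT t) \<and> grz_class ?K (p + m) b \<and>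
     (\<forall>cs ns as. code_args V val A p m q cs ns as \<longrightarrow>
        FT t (cs @ ns @ as) = t (map val cs) ns as \<and>
        (\<forall>z. (\<forall>a\<in>set as. a \<le> z) \<longrightarrow> t (map val cs) ns as \<le> b (cs @ ns) + z))" ..
  from bchoice[OF this] obtain bT where FT: "\<And>t. t \<in> set ts \<Longrightarrow> grz_class ?K (p + m + q) (FT t)"
    "\<And>t. t \<in> set ts \<Longrightarrow> grz_class ?K (p + m) (bT t)"
    "\<And>t cs ns as. t \<in> set ts \<Longrightarrow> code_args V val A p m q cs ns as \<Longrightarrow>
        FT t (cs @ ns @ as) = t (map val cs) ns as"
    "\<And>t cs ns as z. t \<in> set ts \<Longrightarrow> code_args V val A p m q cs ns as \<Longrightarrow>
        (\<And>a. a \<in> set as \<Longrightarrow> a \<le> z) \<Longrightarrow> t (map val cs) ns as \<le> bT t (cs @ ns) + z"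
    by blast
  let ?S = "\<lambda>xs. map (\<lambda>s. FS s xs) ss" and ?T = "\<lambda>xs. map (\<lambda>t. FT t xs) ts"
  have glS: "grz_list ?K (p + m) (length ss) ?S"
    by (intro grz_list_map FS)
  show ?thesis
  proof (rule simulableI)
    have "grz_list ?K (p + m + q) (p + (length ss + length ts))
        (\<lambda>xs. take p xs @ ?S (take (p + m) xs) @ ?T xs)"
      by (intro grz_list_append grz_list_take[OF grz_list_id] grz_list_map FT
          grz_list_compose[OF grz_list_take[OF grz_list_id] glS]) auto
    then show "grz_class ?K (p + m + q) (\<lambda>xs. F (take p xs @ ?S (take (p + m) xs) @ ?T xs))"
      using grz_compose[OF F] by (simp add: add.assoc)
    have "grz_list ?K (p + m) (p + length ss) (\<lambda>xs. take p xs @ ?S xs)"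
      by (intro grz_list_append grz_list_take[OF grz_list_id] glS) auto
    moreover have "grz_class ?K (p + m) (\<lambda>xs. sum_list (map (\<lambda>t. bT t xs) ts))"
      by (intro grz_sum_list[OF grz_list_map] FT)
    ultimately show "grz_class ?K (p + m)
        (\<lambda>xs. b (take p xs @ ?S xs) + sum_list (map (\<lambda>t. bT t xs) ts))"
      by (intro grz_add grz_compose[OF b])
  next
    fix cs ns as assume *: "code_args V val A p m q cs ns as"
    have args0: "code_args V val A p m 0 cs ns []" using * by (simp add: code_args_def)
    let ?ns = "map (\<lambda>s. s (map val cs) ns []) ss" and ?as = "map (\<lambda>t. t (map val cs) ns as) ts"
    have lens: "length cs = p" "length ns = m" using * by (auto simp: code_args_def)
    have argsh: "code_args V val A p (length ss) (length ts) cs ?ns ?as"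
      using * by (simp add: code_args_def)
    have S: "?S (cs @ ns) = ?ns" using FS(2)[OF _ args0] by simp
    have T: "?T (cs @ ns @ as) = ?as" using FT(3)[OF _ *] by simp
    have tk: "take p (cs @ ns @ as) = cs" "take (p + m) (cs @ ns @ as) = cs @ ns"
        "take p (cs @ ns) = cs"
      using lens by simp_all
    have fh: "f (map val cs) ns as = h (map val cs) ?ns ?as"
      using f code_args_args[OF *] by auto
    then show "F (take p (cs @ ns @ as) @ ?S (take (p + m) (cs @ ns @ as)) @ ?T (cs @ ns @ as))
        = f (map val cs) ns as"
      unfolding tk S T using Fg[OF argsh] by simp
    fix z assume z: "\<And>a. a \<in> set as \<Longrightarrow> a \<le> z"
    have "a \<le> sum_list (map (\<lambda>t. bT t (cs @ ns)) ts) + z" if "a \<in> set ?as" for a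
    proof -
      from that obtain t where t: "t \<in> set ts" "a = t (map val cs) ns as" by auto
      then have "bT t (cs @ ns) \<le> sum_list (map (\<lambda>t. bT t (cs @ ns)) ts)"
        by (intro member_le_sum_list) auto
      then show ?thesis using FT(4)[OF t(1) * z] t(2) by simp
    qed
    from bg[OF argsh this] show "f (map val cs) ns as \<le>
        b (take p (cs @ ns) @ ?S (cs @ ns)) + sum_list (map (\<lambda>t. bT t (cs @ ns)) ts) + z"
      unfolding tk S using fh by simp
  qed
qed

section \<open>Ordinal recursion as recursion along a descent\<close>

context code_system
begin

lemma grz_nx': "grz_class (Suc (Suc k)) n f \<Longrightarrow> grz_class (Suc (Suc k)) n g \<Longrightarrow>
    grz_class (Suc (Suc k)) n (\<lambda>xs. nx (f xs) (g xs))"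
  by (rule grz_lift2[OF grz_nx])

lemma grz_L': "grz_class (Suc (Suc k)) n f \<Longrightarrow> grz_class (Suc (Suc k)) n g \<Longrightarrow>
    grz_class (Suc (Suc k)) n (\<lambda>xs. L (f xs) (g xs))"
  by (rule grz_lift2[OF grz_L])

lemma grz_M': "grz_class (Suc (Suc k)) n f \<Longrightarrow> grz_class (Suc (Suc k)) n g \<Longrightarrow>
    grz_class (Suc (Suc k)) n (\<lambda>xs. M (f xs) (g xs))"
  by (rule grz_lift2[OF grz_M])

lemma grz_kd': "grz_class (Suc (Suc k)) n f \<Longrightarrow> grz_class (Suc (Suc k)) n (\<lambda>xs. kd (f xs))"
  by (rule grz_lift1[OF grz_kd])

definition descent :: "nat \<Rightarrow> nat \<Rightarrow> nat \<Rightarrow> nat" where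
  "descent c x t = ((\<lambda>c. nx c x) ^^ t) c"

lemma descent_simps [simp]: "descent c x 0 = c" "descent c x (Suc t) = nx (descent c x t) x"
  by (simp_all add: descent_def)

lemma descent_V: "c \<in> V \<Longrightarrow> descent c x t \<in> V"
  by (induction t) (auto intro: nx_V)

lemma descent_le: "c \<in> V \<Longrightarrow> descent c x t \<le> M c x"
proof -
  assume c: "c \<in> V"
  have "M (descent c x t) x \<le> M c x"
    by (induction t) (auto intro: order_trans[OF M_nx[OF descent_V[OF c]]])
  then show ?thesis using code_le[OF descent_V[OF c], of x t x] by simp
qed

text \<open>The rank drops at each step until kind 0 is reached, and there the code stays put. Hence
  stopping at the bound \<open>L\<close>, which may exceed the true length, is safe.\<close>

lemma descent_end:
  assumes c: "c \<in> V"
  shows "kd (descent c x (L c x)) = 0"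
proof -
  have "kd (descent c x t) = 0 \<or> r (descent c x t) x + t \<le> r c x" for t
  proof (induction t)
    case (Suc t)
    show ?case
    proof (cases "kd (descent c x t) = 0")
      case True
      then show ?thesis using nx_zero[OF descent_V[OF c]] by simp
    next
      case False
      then show ?thesis using Suc rank_less[OF descent_V[OF c] False, of x] by simp
    qed
  qed simp
  from this[of "L c x"] have "kd (descent c x (L c x)) = 0 \<or> r (descent c x (L c x)) x = 0"
    using rank_le[OF c, of x] by auto
  then show ?thesis
    using rank_less[OF descent_V[OF c], of x "L c x" x] by (cases "kd (descent c x (L c x)) = 0") auto
qed

text \<open>Simulation is promised only at ordinals in \<open>A\<close>. Every step keeps the value
  or moves to an immediate predecessor, so a descent never leaves a downset.\<close>

lemma val_nx_downset:
  assumes "downset A" "c \<in> V" "val c \<in> A"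
  shows "val (nx c x) \<in> A"
proof -
  have step: "\<beta> \<in> A" if "cord_step \<beta> (val c)" for \<beta>
    using assms(1,3) that unfolding downset_def cord_prec_def by blast
  consider "kd c = 0" | "kd c = 1" | "kd c = 2" | "2 < kd c" by linarith
  then show ?thesis
  proof cases
    case 1 then show ?thesis using assms nx_zero by simp
  next
    case 2 then show ?thesis
      using step[of "val (nx c x)"] cord_step.intros(1) val_suc[OF assms(2) 2, of x] by simp
  next
    case 3 then show ?thesis
      using step[of "val (nx c x)"] cord_step.intros(2)[of "\<lambda>x. val (nx c x)" x]
        val_lim[OF assms(2) 3] by simp
  next
    case 4 then show ?thesis using assms val_silent by simp
  qed
qed

lemma val_descent_downset:
  "downset A \<Longrightarrow> c \<in> V \<Longrightarrow> val c \<in> A \<Longrightarrow> val (descent c x t) \<in> A"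
  by (induction t) (auto intro: val_nx_downset descent_V)

text \<open>The function is evaluated from the end of the descent back to its start. Since
  \<open>q\<close> sees only normal arguments, the limit index is the same in all rounds, so the
  descent is fixed in advance.\<close>

lemma simulable_ord_rec:
  assumes down: "downset A"
    and "simulable k V val A p m q g"
    and "simulable k V val A (Suc p) m (Suc q) hsuc"
    and "simulable k V val A (Suc p) m (Suc q) hlim"
    and "simulable k V val A 0 m 0 qf"
    and f: "\<forall>(\<nu>s, ns, as) \<in> args A p m q.
       (OZero \<in> A \<longrightarrow> f (OZero # \<nu>s) ns as = g \<nu>s ns as) \<and>
       (\<forall>\<mu>. OSuc \<mu> \<in> A \<longrightarrow>
          f (OSuc \<mu> # \<nu>s) ns as = hsuc (\<mu> # \<nu>s) ns (f (\<mu> # \<nu>s) ns as # as)) \<and>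
       (\<forall>\<mu>. OLim \<mu> \<in> A \<longrightarrow>
          f (OLim \<mu> # \<nu>s) ns as
            = hlim (OLim \<mu> # \<nu>s) ns (f (\<mu> (qf [] ns []) # \<nu>s) ns as # as))"
  shows "simulable k V val A (Suc p) m q f"
proof -
  let ?K = "Suc (Suc k)"
  from assms(2) obtain Fg bg where Fg: "grz_class ?K (p + m + q) Fg"
    and bg: "grz_class ?K (p + m) bg"
    and Fg_eq: "\<And>cs ns as. code_args V val A p m q cs ns as \<Longrightarrow>
      Fg (cs @ ns @ as) = g (map val cs) ns as"
    and g_le: "\<And>cs ns as z. code_args V val A p m q cs ns as \<Longrightarrow>
      (\<And>a. a \<in> set as \<Longrightarrow> a \<le> z) \<Longrightarrow> g (map val cs) ns as \<le> bg (cs @ ns) + z"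
    by (rule simulableE) blast
  from assms(3) obtain Fs bs where Fs: "grz_class ?K (Suc p + m + Suc q) Fs"
    and bs: "grz_class ?K (Suc p + m) bs"
    and Fs_eq: "\<And>cs ns as. code_args V val A (Suc p) m (Suc q) cs ns as \<Longrightarrow>
      Fs (cs @ ns @ as) = hsuc (map val cs) ns as"
    and s_le: "\<And>cs ns as z. code_args V val A (Suc p) m (Suc q) cs ns as \<Longrightarrow>
      (\<And>a. a \<in> set as \<Longrightarrow> a \<le> z) \<Longrightarrow> hsuc (map val cs) ns as \<le> bs (cs @ ns) + z"
    by (rule simulableE) blast
  from assms(4) obtain Fl bl where Fl: "grz_class ?K (Suc p + m + Suc q) Fl"
    and bl: "grz_class ?K (Suc p + m) bl"
    and Fl_eq: "\<And>cs ns as. code_args V val A (Suc p) m (Suc q) cs ns as \<Longrightarrow>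
      Fl (cs @ ns @ as) = hlim (map val cs) ns as"
    and l_le: "\<And>cs ns as z. code_args V val A (Suc p) m (Suc q) cs ns as \<Longrightarrow>
      (\<And>a. a \<in> set as \<Longrightarrow> a \<le> z) \<Longrightarrow> hlim (map val cs) ns as \<le> bl (cs @ ns) + z"
    by (rule simulableE) blast
  from assms(5) obtain Fq where Fq: "grz_class ?K m Fq"
    and Fq_eq: "\<And>ns. length ns = m \<Longrightarrow> Fq ns = qf [] ns []"
    by (rule simulableE) (metis (no_types, lifting) add.right_neutral add_0 append_Nil append_Nil2
      code_args_def image_empty empty_set empty_subsetI list.size(3) list.simps(8))
  obtain ms where ms: "mono ms" "grz_class ?K 1 (\<lambda>l. ms (l ! 0))"
    "\<And>xs. length xs = Suc p + m \<Longrightarrow> bs xs \<le> ms (sum_list xs)"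
    using grz_mono_majorant[OF bs] by blast
  obtain ml where ml: "mono ml" "grz_class ?K 1 (\<lambda>l. ml (l ! 0))"
    "\<And>xs. length xs = Suc p + m \<Longrightarrow> bl xs \<le> ml (sum_list xs)"
    using grz_mono_majorant[OF bl] by blast

  define X where "X xs = Fq (take m (drop (Suc p) xs))" for xs
  define Lx where "Lx xs = L (xs ! 0) (X xs)" for xs
  define Mx where "Mx xs = M (xs ! 0) (X xs)" for xs
  define D where "D = trunc_rec Mx (\<lambda>xs. xs ! 0) (\<lambda>l. nx (l ! 1) (X (tl (tl l))))"
  \<comment> \<open>No code in the descent exceeds \<open>Mx xs\<close>, so this bounds the sum of
    the arguments at which the monotone majorants of \<open>bs\<close> and \<open>bl\<close> have to
    be taken.\<close>
  define S where "S xs = Mx xs + sum_list (take (p + m) (tl xs))" for xs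
  define w where "w xs = ms (S xs) + ml (S xs)" for xs
  \<comment> \<open>The \<open>take\<close> lets the same expression be used with and without safe
    arguments: as the bound of the simulation, and inside \<open>B\<close>, which truncates the
    recursion.\<close>
  define b where "b xs = bg (take (p + m) (tl xs)) + Lx xs * w xs" for xs
  define B where "B xs = b xs + sum_list (drop (p + m) (tl xs))" for xs
  define E where "E v xs = take (p + m) (tl xs) @ v # drop (p + m) (tl xs)" for v :: nat and xs
  \<comment> \<open>Here \<open>l\<close> lists the round, the previous value and the arguments.
    Round \<open>y\<close> treats the code reached after \<open>Lx xs - Suc y\<close> steps, which
    is recomputed from the start by the inner recursion \<open>D\<close>.\<close>
  define u where "u l = (let xs = tl (tl l); d = D (Lx xs - Suc (l ! 0)) xs in
     if kd d = 0 then Fg (tl xs)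
     else if kd d = 1 then Fs (nx d (X xs) # E (l ! 1) xs)
     else if kd d = 2 then Fl (d # E (l ! 1) xs) else l ! 1)" for l
  define F where "F xs = trunc_rec B (\<lambda>xs. Fg (tl xs)) u (Lx xs) xs" for xs

  have gX: "grz_class ?K (Suc p + m + j) X" for j
    unfolding X_def
    by (intro grz_compose[OF Fq] grz_list_take[of _ _ "m + j"] grz_list_drop[OF grz_list_id]) auto
  have gLx: "grz_class ?K (Suc p + m + j) Lx" for j
    unfolding Lx_def by (intro grz_L' gX grz_nth) simp
  have gMx: "grz_class ?K (Suc p + m + j) Mx" for j
    unfolding Mx_def by (intro grz_M' gX grz_nth) simp
  have gt: "grz_list ?K (Suc p + m + j) (p + m) (\<lambda>xs. take (p + m) (tl xs))" for j
    by (intro grz_list_take[of _ _ "p + m + j"] grz_list_tl)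
      (use grz_list_id[of ?K "Suc p + m + j"] in auto)
  have gd: "grz_list ?K (Suc p + m + j) j (\<lambda>xs. drop (p + m) (tl xs))" for j
    by (intro grz_list_drop[of _ _ "p + m + j"] grz_list_tl)
      (use grz_list_id[of ?K "Suc p + m + j"] in auto)
  have gS: "grz_class ?K (Suc p + m + j) S" for j
    unfolding S_def by (intro grz_add gMx grz_sum_list[OF gt])
  have gb: "grz_class ?K (Suc p + m + j) b" for j
    unfolding b_def w_def
    by (intro grz_add grz_mult gLx grz_compose[OF bg gt] grz_lift1[OF ms(2)] grz_lift1[OF ml(2)] gS)
      simp
  have gB: "grz_class ?K (Suc p + m + q) B"
    unfolding B_def by (intro grz_add gb grz_sum_list[OF gd])
  let ?n = "Suc p + m + q"
  have g2: "grz_list ?K (Suc (Suc ?n)) ?n (\<lambda>l. tl (tl l))"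
    by (intro grz_list_tl grz_list_id)
  have gD: "grz_class ?K (Suc (Suc ?n)) (\<lambda>l. D (Lx (tl (tl l)) - Suc (l ! 0)) (tl (tl l)))"
    unfolding D_def
    by (intro grz_trunc_rec[OF gMx[of q]] g2 grz_diff grz_Suc grz_nth grz_nx'
        grz_compose[OF gLx g2] grz_compose[OF gX g2]) simp_all
  have gE: "grz_list ?K (Suc (Suc ?n)) (Suc (p + m + q)) (\<lambda>l. E (l ! 1) (tl (tl l)))"
  proof -
    have "grz_list ?K (Suc (Suc ?n)) (p + m + Suc q) (\<lambda>l. E (l ! 1) (tl (tl l)))"
      unfolding E_def
      by (intro grz_list_append grz_list_Cons grz_nth grz_list_compose[OF g2 gt]
          grz_list_compose[OF g2 gd]) simp
    then show ?thesis by simp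
  qed
  have gFg: "grz_class ?K ?n (\<lambda>xs. Fg (tl xs))"
    using grz_tl[OF Fg] by simp
  have gu: "grz_class ?K (Suc (Suc ?n)) u"
  proof -
    have "grz_class ?K (Suc (Suc ?n)) (\<lambda>l. Fs (nx (D (Lx (tl (tl l)) - Suc (l ! 0)) (tl (tl l)))
        (X (tl (tl l))) # E (l ! 1) (tl (tl l))))"
      using grz_compose[OF Fs, of "Suc (Suc ?n)"]
        grz_list_Cons[OF grz_nx'[OF gD grz_compose[OF gX g2]] gE] by simp
    moreover have "grz_class ?K (Suc (Suc ?n)) (\<lambda>l. Fl (D (Lx (tl (tl l)) - Suc (l ! 0)) (tl (tl l))
        # E (l ! 1) (tl (tl l))))"
      using grz_compose[OF Fl, of "Suc (Suc ?n)"] grz_list_Cons[OF gD gE] by simp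
    ultimately show ?thesis
      unfolding u_def Let_def
      by (intro grz_if grz_if_eq grz_kd' gD grz_const grz_nth grz_compose[OF gFg g2]) simp_all
  qed
  have gF: "grz_class ?K ?n F"
    unfolding F_def by (intro grz_trunc_rec[OF gB gFg gu gLx grz_list_id])

  have main: "F (c # cs @ ns @ as) = f (val c # map val cs) ns as \<and>
      (\<forall>z. (\<forall>a\<in>set as. a \<le> z) \<longrightarrow> f (val c # map val cs) ns as \<le> b (c # cs @ ns) + z)"
    if *: "code_args V val A (Suc p) m q (c # cs) ns as" for c cs ns as
  proof -
    let ?xs = "c # cs @ ns @ as" and ?vs = "map val cs"
    have c: "c \<in> V" "val c \<in> A" and cs: "code_args V val A p m q cs ns as"
      and lens: "length cs = p" "length ns = m"
      using * by (auto simp: code_args_def)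
    have cons: "code_args V val A (Suc p) m (Suc q) (d # cs) ns (v # as)"
      if "d \<in> V" "val d \<in> A" for d v
      using that cs by (auto simp: code_args_def)
    define x where "x = qf [] ns []"
    have X: "X ?xs = x" "X (c # cs @ ns) = x"
      using lens Fq_eq[of ns] by (auto simp: X_def x_def)
    define l where "l = L c x"
    have Lx: "Lx ?xs = l" "Lx (c # cs @ ns) = l" by (auto simp: Lx_def X l_def)
    have Mx: "Mx ?xs = M c x" "Mx (c # cs @ ns) = M c x" by (auto simp: Mx_def X)
    define W where "W = w ?xs"
    have W: "w (c # cs @ ns) = W" and S: "S ?xs = M c x + sum_list (cs @ ns)"
      using lens by (auto simp: W_def w_def S_def Mx)
    have b: "b ?xs = bg (cs @ ns) + l * W" "b (c # cs @ ns) = bg (cs @ ns) + l * W"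
      using lens by (auto simp: b_def Lx W simp flip: W_def)
    have B: "B ?xs = bg (cs @ ns) + l * W + sum_list as"
      using lens by (simp add: B_def b)
    have E: "E v ?xs = cs @ ns @ v # as" for v
      using lens by (simp add: E_def)
    let ?d = "descent c x"
    have dV: "?d t \<in> V" and dA: "val (?d t) \<in> A" and dM: "?d t \<le> M c x" for t
      using descent_V c val_descent_downset[OF down] descent_le by auto
    have D: "D t ?xs = ?d t" for t
    proof (induction t)
      case 0
      then show ?case using dM[of 0] by (simp add: D_def Mx)
    next
      case (Suc t)
      then show ?case using dM[of "Suc t"] by (simp add: D_def Mx X)
    qed
    have zs: "\<forall>a\<in>set as. a \<le> sum_list as"
      by (simp add: member_le_sum_list)
    have f0: "f (OZero # ?vs) ns as = g ?vs ns as" if "OZero \<in> A"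
      using f code_args_args[OF cs] that by auto
    have fs: "f (OSuc \<mu> # ?vs) ns as = hsuc (\<mu> # ?vs) ns (f (\<mu> # ?vs) ns as # as)"
      if "OSuc \<mu> \<in> A" for \<mu>
      using f code_args_args[OF cs] that by auto
    have fl: "f (OLim \<mu> # ?vs) ns as = hlim (OLim \<mu> # ?vs) ns (f (\<mu> x # ?vs) ns as # as)"
      if "OLim \<mu> \<in> A" for \<mu>
      using f code_args_args[OF cs] that unfolding x_def by auto
    let ?R = "\<lambda>y. trunc_rec B (\<lambda>xs. Fg (tl xs)) u y ?xs"
    have zero: "f (val (?d t) # ?vs) ns as = Fg (cs @ ns @ as)" if "kd (?d t) = 0" for t
      using val_zero[OF dV that] dA[of t] f0 Fg_eq[OF cs] by simp
    \<comment> \<open>Each round adds at most \<open>W\<close>: a step function exceeds the maximum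
      of its safe arguments, among them the previous value, by no more than its own bound, and
      \<open>W\<close> dominates that bound at all codes of the descent.\<close>
    have R: "?R y = f (val (?d (l - y)) # ?vs) ns as \<and>
        (\<forall>z. (\<forall>a\<in>set as. a \<le> z) \<longrightarrow> ?R y \<le> bg (cs @ ns) + y * W + z)" if "y \<le> l" for y
      using that
    proof (induction y)
      case 0
      have "kd (?d l) = 0" unfolding l_def by (rule descent_end[OF c(1)])
      from zero[OF this] have eq: "f (val (?d l) # ?vs) ns as = Fg (cs @ ns @ as)" .
      have le: "Fg (cs @ ns @ as) \<le> bg (cs @ ns) + z" if "\<forall>a\<in>set as. a \<le> z" for z
        using g_le[OF cs] Fg_eq[OF cs] that by simp
      have "Fg (cs @ ns @ as) \<le> B ?xs"
        using le[OF zs] B by simp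
      then show ?case using eq le by simp
    next
      case (Suc y)
      define t where "t = l - Suc y"
      have t: "l - y = Suc t" using Suc.prems by (simp add: t_def)
      define v where "v = ?R y"
      have v: "v = f (val (?d (Suc t)) # ?vs) ns as"
        and vle: "\<And>z. (\<forall>a\<in>set as. a \<le> z) \<Longrightarrow> v \<le> bg (cs @ ns) + y * W + z"
        using Suc t unfolding v_def by auto
      let ?U = "u (y # v # ?xs)"
      have ms': "bs (d # cs @ ns) \<le> W" if "d \<le> M c x" for d
      proof -
        have "bs (d # cs @ ns) \<le> ms (sum_list (d # cs @ ns))"
          using lens by (intro ms) simp
        also have "\<dots> \<le> ms (S ?xs)"
          using that by (intro monoD[OF ms(1)]) (simp add: S)
        finally show ?thesis by (simp add: W_def w_def)
      qed
      have ml': "bl (d # cs @ ns) \<le> W" if "d \<le> M c x" for d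
      proof -
        have "bl (d # cs @ ns) \<le> ml (sum_list (d # cs @ ns))"
          using lens by (intro ml) simp
        also have "\<dots> \<le> ml (S ?xs)"
          using that by (intro monoD[OF ml(1)]) (simp add: S)
        finally show ?thesis by (simp add: W_def w_def)
      qed
      have U: "?U = f (val (?d t) # ?vs) ns as \<and>
        (\<forall>z. (\<forall>a\<in>set as. a \<le> z) \<longrightarrow> ?U \<le> bg (cs @ ns) + Suc y * W + z)"
      proof -
        consider "kd (?d t) = 0" | "kd (?d t) = 1" | "kd (?d t) = 2" | "2 < kd (?d t)" by linarith
        then show ?thesis
        proof cases
          \<comment> \<open>The descent may become stationary before \<open>l\<close> steps. Rounds
            spent there return the value of \<open>g\<close> again.\<close>
          case 1
          then have U: "?U = Fg (cs @ ns @ as)"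
            by (simp add: u_def Lx D flip: t_def)
          have "Fg (cs @ ns @ as) \<le> bg (cs @ ns) + Suc y * W + z" if "\<forall>a\<in>set as. a \<le> z" for z
            using g_le[OF cs, of z] Fg_eq[OF cs] that by force
          then show ?thesis using zero[OF 1] U by simp
        next
          case 2
          have ca: "code_args V val A (Suc p) m (Suc q) (?d (Suc t) # cs) ns (v # as)"
            by (rule cons[OF dV dA])
          have "?U = Fs ((?d (Suc t) # cs) @ ns @ (v # as))"
            using 2 by (simp add: u_def Lx D E X flip: t_def)
          also have "\<dots> = hsuc (val (?d (Suc t)) # ?vs) ns (v # as)"
            using Fs_eq[OF ca] by simp
          finally have U: "?U = hsuc (val (?d (Suc t)) # ?vs) ns (v # as)" .
          have sc: "val (?d t) = OSuc (val (?d (Suc t)))"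
            using val_suc[OF dV 2, of x] by simp
          have "?U \<le> bg (cs @ ns) + Suc y * W + z" if z: "\<forall>a\<in>set as. a \<le> z" for z
          proof -
            have "a \<le> bg (cs @ ns) + y * W + z" if "a \<in> set (v # as)" for a
              using that vle[OF z] z by (auto intro: order_trans)
            from s_le[OF ca this] have "?U \<le> bs (?d (Suc t) # cs @ ns) + (bg (cs @ ns) + y * W + z)"
              unfolding U by simp
            then show ?thesis using ms'[OF dM[of "Suc t"]] by simp
          qed
          then show ?thesis using U v fs[of "val (?d (Suc t))"] dA[of t] sc by simp
        next
          case 3
          have ca: "code_args V val A (Suc p) m (Suc q) (?d t # cs) ns (v # as)"
            by (rule cons[OF dV dA])
          have "?U = Fl ((?d t # cs) @ ns @ (v # as))"
            using 3 by (simp add: u_def Lx D E X flip: t_def)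
          also have "\<dots> = hlim (val (?d t) # ?vs) ns (v # as)"
            using Fl_eq[OF ca] by simp
          finally have U: "?U = hlim (val (?d t) # ?vs) ns (v # as)" .
          have lm: "val (?d t) = OLim (\<lambda>x. val (nx (?d t) x))"
            by (rule val_lim[OF dV 3])
          have "?U \<le> bg (cs @ ns) + Suc y * W + z" if z: "\<forall>a\<in>set as. a \<le> z" for z
          proof -
            have "a \<le> bg (cs @ ns) + y * W + z" if "a \<in> set (v # as)" for a
              using that vle[OF z] z by (auto intro: order_trans)
            from l_le[OF ca this] have "?U \<le> bl (?d t # cs @ ns) + (bg (cs @ ns) + y * W + z)"
              unfolding U by simp
            then show ?thesis using ml'[OF dM[of t]] by simp
          qed
          moreover have "f (val (?d t) # ?vs) ns as = hlim (val (?d t) # ?vs) ns (v # as)"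
            using fl[of "\<lambda>x. val (nx (?d t) x)"] dA[of t] v by (simp flip: lm)
          ultimately show ?thesis using U by simp
        next
          case 4
          then have "?U = v"
            by (simp add: u_def Lx D flip: t_def)
          moreover have "val (?d (Suc t)) = val (?d t)"
            using val_silent[OF dV 4, of x] by simp
          moreover have "v \<le> bg (cs @ ns) + Suc y * W + z" if "\<forall>a\<in>set as. a \<le> z" for z
            using vle[OF that] by simp
          ultimately show ?thesis using v by simp
        qed
      qed
      have "Suc y * W \<le> l * W" using Suc.prems by (intro mult_le_mono1)
      moreover have "?U \<le> bg (cs @ ns) + Suc y * W + sum_list as"
        using U zs by blast
      ultimately have "?U \<le> B ?xs"
        unfolding B by linarith
      then have "?R (Suc y) = ?U" unfolding v_def by (simp del: append.simps)
      with U show ?case unfolding t_def by metis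
    qed
    from R[of l] show ?thesis
      unfolding F_def Lx b by auto
  qed
  show ?thesis
  proof (rule simulableI)
    show "grz_class ?K (Suc p + m + q) F" by (rule gF)
    show "grz_class ?K (Suc p + m) b" using gb[of 0] by simp
  next
    fix cs ns as assume *: "code_args V val A (Suc p) m q cs ns as"
    then obtain c cs' where cs: "cs = c # cs'" by (cases cs) (auto simp: code_args_def)
    show "F (cs @ ns @ as) = f (map val cs) ns as"
      using main[of c cs' ns as] * cs by simp
    fix z assume "\<And>a. a \<in> set as \<Longrightarrow> a \<le> z"
    then show "f (map val cs) ns as \<le> b (cs @ ns) + z"
      using main[of c cs' ns as] * cs by simp
  qed
qed

end

section \<open>Finitely many ordinal constants suffice\<close>

definition simulable_over ::
    "cord set \<Rightarrow> nat \<Rightarrow> nat \<Rightarrow> nat \<Rightarrow> (cord list \<Rightarrow> nat list \<Rightarrow> nat list \<Rightarrow> nat) \<Rightarrow> cord set \<Rightarrow> bool" where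
  "simulable_over A p m q f S \<longleftrightarrow> finite S \<and> S \<subseteq> A \<and> (\<forall>k V val kd nx L M r.
    code_system k V val kd nx L M r \<longrightarrow> S \<subseteq> val ` V \<longrightarrow> simulable k V val A p m q f)"

lemma simulable_overI:
  assumes "finite S" "S \<subseteq> A"
    and "\<And>k V val kd nx L M r. code_system k V val kd nx L M r \<Longrightarrow> S \<subseteq> val ` V \<Longrightarrow>
      simulable k V val A p m q f"
  shows "simulable_over A p m q f S"
  using assms unfolding simulable_over_def by blast

lemma simulable_overD:
  assumes "simulable_over A p m q f S"
  shows "finite S" "S \<subseteq> A"
    and "code_system k V val kd nx L M r \<Longrightarrow> S \<subseteq> val ` V \<Longrightarrow> simulable k V val A p m q f"
  using assms unfolding simulable_over_def by blast+

text \<open>The set of constants is read off the derivation before a coding is chosen, which is why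
  \<open>simulable_over\<close> quantifies over all code systems: the subderivations can then share
  one system that covers the union of their constants.\<close>

lemma pred_class_simulable:
  assumes down: "downset A" and "pred_class A p m q f"
  shows "\<exists>S. simulable_over A p m q f S"
  using assms(2)
proof induction
  case (zero f)
  show ?case
    by (rule exI[of _ "{}"], rule simulable_overI) (simp_all add: simulable_zero[of f, OF zero])
next
  case (proj_normal i m p q f)
  show ?case
    by (rule exI[of _ "{}"], rule simulable_overI) (simp_all add: simulable_proj_normal[OF proj_normal])
next
  case (proj_safe j q p m f)
  show ?case
    by (rule exI[of _ "{}"], rule simulable_overI) (simp_all add: simulable_proj_safe[OF proj_safe])
next
  case (succ f)
  show ?case
    by (rule exI[of _ "{}"], rule simulable_overI) (simp_all only: simulable_succ[of f, OF succ] finite.emptyI empty_subsetI)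
next
  case (pred f)
  show ?case
    by (rule exI[of _ "{}"], rule simulable_overI) (simp_all only: simulable_pred[of f, OF pred] finite.emptyI empty_subsetI)
next
  case (cond f)
  show ?case
    by (rule exI[of _ "{}"], rule simulable_overI) (simp_all only: simulable_cond[of f, OF cond] finite.emptyI empty_subsetI)
next
  case (ord_rec p m q g hsuc hlim qf f)
  then obtain S1 S2 S3 S4 where S: "simulable_over A p m q g S1"
    "simulable_over A (Suc p) m (Suc q) hsuc S2" "simulable_over A (Suc p) m (Suc q) hlim S3"
    "simulable_over A 0 m 0 qf S4"
    by blast
  show ?case
  proof (rule exI[of _ "S1 \<union> S2 \<union> S3 \<union> S4"], rule simulable_overI)
    fix k V val kd nx L M r
    assume cs: "code_system k V val kd nx L M r" and "S1 \<union> S2 \<union> S3 \<union> S4 \<subseteq> val ` V"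
    then have sims: "simulable k V val A p m q g" "simulable k V val A (Suc p) m (Suc q) hsuc"
      "simulable k V val A (Suc p) m (Suc q) hlim" "simulable k V val A 0 m 0 qf"
      using S[THEN simulable_overD(3), OF cs] by simp_all
    show "simulable k V val A (Suc p) m q f"
      by (rule code_system.simulable_ord_rec[OF cs down sims ord_rec.hyps(5)])
  qed (use S[THEN simulable_overD(1)] S[THEN simulable_overD(2)] in simp_all)
next
  case (safe_comp p ss ts h m q f)
  from safe_comp.IH(1) obtain S where S: "simulable_over A p (length ss) (length ts) h S" ..
  from safe_comp.IH(2) have "\<forall>s\<in>set ss. \<exists>S. simulable_over A p m 0 s S" by blast
  from bchoice[OF this] obtain SS where SS: "\<And>s. s \<in> set ss \<Longrightarrow> simulable_over A p m 0 s (SS s)"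
    by blast
  from safe_comp.IH(3) have "\<forall>t\<in>set ts. \<exists>S. simulable_over A p m q t S" by blast
  from bchoice[OF this] obtain ST where ST: "\<And>t. t \<in> set ts \<Longrightarrow> simulable_over A p m q t (ST t)"
    by blast
  show ?case
  proof (rule exI[of _ "S \<union> \<Union> (SS ` set ss) \<union> \<Union> (ST ` set ts)"], rule simulable_overI)
    fix k V val kd nx L M r
    assume cs: "code_system k V val kd nx L M r"
      and sub: "S \<union> \<Union> (SS ` set ss) \<union> \<Union> (ST ` set ts) \<subseteq> val ` V"
    have s: "\<forall>s\<in>set ss. simulable k V val A p m 0 s"
      using simulable_overD(3)[OF SS cs] sub by blast
    have t: "\<forall>t\<in>set ts. simulable k V val A p m q t"
      using simulable_overD(3)[OF ST cs] sub by blast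
    have h: "simulable k V val A p (length ss) (length ts) h"
      using simulable_overD(3)[OF S cs] sub by blast
    show "simulable k V val A p m q f"
      by (rule simulable_safe_comp[OF h s t safe_comp.hyps(2)])
  next
    show "finite (S \<union> \<Union> (SS ` set ss) \<union> \<Union> (ST ` set ts))"
      using simulable_overD(1)[OF S] simulable_overD(1)[OF SS] simulable_overD(1)[OF ST] by blast
    show "S \<union> \<Union> (SS ` set ss) \<union> \<Union> (ST ` set ts) \<subseteq> A"
      using simulable_overD(2)[OF S] simulable_overD(2)[OF SS] simulable_overD(2)[OF ST] by blast
  qed
next
  case (subst_const p m q g \<alpha> i f)
  from subst_const.IH obtain S where S: "simulable_over A (Suc p) m q g S" ..
  show ?case
  proof (rule exI[of _ "insert \<alpha> S"], rule simulable_overI)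
    fix k V val kd nx L M r
    assume cs: "code_system k V val kd nx L M r" and sub: "insert \<alpha> S \<subseteq> val ` V"
    then obtain c where c: "c \<in> V" "\<alpha> = val c" by auto
    have g: "simulable k V val A (Suc p) m q g" using simulable_overD(3)[OF S cs] sub by simp
    have "val c \<in> A" using c(2) subst_const.hyps(2) by simp
    from simulable_subst_const[OF g c(1) this subst_const.hyps(3) subst_const.hyps(4)[unfolded c(2)]]
    show "simulable k V val A p m q f" .
  qed (use simulable_overD(1,2)[OF S] subst_const.hyps(2) in auto)
next
  case (exchange p m q g i j f)
  from exchange.IH obtain S where S: "simulable_over A p m q g S" ..
  show ?case
    by (rule exI[of _ S], rule simulable_overI[OF simulable_overD(1,2)[OF S]])
      (rule simulable_exchange[OF simulable_overD(3)[OF S] exchange.hyps(2,3,4)])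
next
  case (weakening p m q g f)
  from weakening.IH obtain S where S: "simulable_over A p m q g S" ..
  show ?case
    by (rule exI[of _ S], rule simulable_overI[OF simulable_overD(1,2)[OF S]])
      (rule simulable_weakening[OF simulable_overD(3)[OF S] weakening.hyps(2)])
next
  case (contraction p m q g f)
  from contraction.IH obtain S where S: "simulable_over A (Suc (Suc p)) m q g S" ..
  show ?case
    by (rule exI[of _ S], rule simulable_overI[OF simulable_overD(1,2)[OF S]])
      (rule simulable_contraction[OF simulable_overD(3)[OF S] contraction.hyps(2)])
qed

definition codable :: "nat \<Rightarrow> cord set \<Rightarrow> bool" where
  "codable k X \<longleftrightarrow> (\<exists>V val kd nx L M r. code_system k V val kd nx L M r \<and> X \<subseteq> val ` V)"

text \<open>With neither ordinal nor safe arguments the simulating function computes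
  \<open>f\<close> itself, so only the coding of finite subsets of \<open>A\<close> remains.\<close>

lemma PredR_subset_Grz:
  assumes "downset A"
    and "\<And>S. finite S \<Longrightarrow> S \<subseteq> A \<Longrightarrow> codable k S"
  shows "PredR A \<subseteq> Grz (k + 2)"
proof
  fix nf assume "nf \<in> PredR A"
  then obtain n f f' where nf: "nf = (n, f)" and f': "pred_class A 0 n 0 f'"
    and f: "\<And>ns. length ns = n \<Longrightarrow> f ns = f' [] ns []"
    by (auto simp: PredR_def)
  from pred_class_simulable[OF assms(1) f'] obtain S where S: "simulable_over A 0 n 0 f' S" ..
  obtain V val kd nx L M r where "code_system k V val kd nx L M r" "S \<subseteq> val ` V"
    using assms(2)[OF simulable_overD(1,2)[OF S]] unfolding codable_def by blast
  then have "simulable k V val A 0 n 0 f'"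
    by (rule simulable_overD(3)[OF S])
  then obtain F b where F: "grz_class (Suc (Suc k)) (0 + n + 0) F"
    and Feq: "\<And>cs ns as. code_args V val A 0 n 0 cs ns as \<Longrightarrow> F (cs @ ns @ as) = f' (map val cs) ns as"
    by (rule simulableE) blast
  have "grz_class (Suc (Suc k)) n f"
  proof (rule grz_cong[of _ _ F])
    fix ns :: "nat list" assume "length ns = n"
    then show "F ns = f ns" using Feq[of "[]" ns "[]"] f by (simp add: code_args_def)
  qed (use F in simp)
  then show "nf \<in> Grz (k + 2)" by (simp add: Grz_def nf)
qed

section \<open>Coding the ordinals of level zero\<close>

lemma oadd_assoc: "oadd (oadd \<alpha> \<beta>) \<gamma> = oadd \<alpha> (oadd \<beta> \<gamma>)"
  by (induction \<gamma>) auto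

lemma oadd_OZero_left [simp]: "oadd OZero \<alpha> = \<alpha>"
  by (induction \<alpha>) auto

text \<open>The sequence for \<omega> starts with 1, so index i yields i + 1 copies of \<alpha>.
  This is the origin of \<open>Suc x\<close> in the codes below.\<close>

lemma omul_omega: "omul \<alpha> omega = OLim (\<lambda>i. oadd (omul \<alpha> (onat i)) \<alpha>)"
  by (simp add: omega_def)

text \<open>At stage \<open>P\<close> a code is an iterated pair listing the coefficients of an ordinal below
  \<open>\<omega>\<^bsup>P+1\<^esup>\<close>; \<open>poly_mult P m\<close> codes \<open>\<omega>\<^sup>P \<cdot> m\<close>.\<close>

primrec poly_mult :: "nat \<Rightarrow> nat \<Rightarrow> nat" where
  "poly_mult 0 m = m"
| "poly_mult (Suc P) m = npair m (poly_mult P 0)"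

primrec poly_val :: "nat \<Rightarrow> nat \<Rightarrow> cord" where
  "poly_val 0 c = onat c"
| "poly_val (Suc P) c =
     oadd (omul (opow omega (onat (Suc P))) (onat (nfst c))) (poly_val P (nsnd c))"

primrec poly_codes :: "nat \<Rightarrow> nat set" where
  "poly_codes 0 = UNIV"
| "poly_codes (Suc P) = {npair i c | i c. c \<in> poly_codes P}"

primrec poly_kind :: "nat \<Rightarrow> nat \<Rightarrow> nat" where
  "poly_kind 0 c = (if c = 0 then 0 else 1)"
| "poly_kind (Suc P) c =
     (if poly_kind P (nsnd c) = 0 then (if nfst c = 0 then 0 else 2) else poly_kind P (nsnd c))"

text \<open>Once the lower coefficients are exhausted, one unit of the leading coefficient is
  exchanged for x + 1 units of the next lower power.\<close>

primrec poly_next :: "nat \<Rightarrow> nat \<Rightarrow> nat \<Rightarrow> nat" where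
  "poly_next 0 c x = c - 1"
| "poly_next (Suc P) c x =
     (if poly_kind P (nsnd c) = 0
      then (if nfst c = 0 then c else npair (nfst c - 1) (poly_mult P (Suc x)))
      else npair (nfst c) (poly_next P (nsnd c) x))"

text \<open>Each unit of the leading coefficient costs one step and then the descent from the x + 1
  lower units it is exchanged for. The degree in \<open>c\<close> and \<open>x\<close> grows with
  \<open>P\<close>, but \<open>P\<close> is fixed.\<close>

primrec poly_rank :: "nat \<Rightarrow> nat \<Rightarrow> nat \<Rightarrow> nat" where
  "poly_rank 0 c x = c"
| "poly_rank (Suc P) c x =
     poly_rank P (nsnd c) x + nfst c * Suc (poly_rank P (poly_mult P (Suc x)) x)"

text \<open>The lower part descends either from its present value or from a fresh
  \<open>poly_mult P (Suc x)\<close>; the maximum covers both.\<close>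

primrec poly_bound :: "nat \<Rightarrow> nat \<Rightarrow> nat \<Rightarrow> nat" where
  "poly_bound 0 c x = c"
| "poly_bound (Suc P) c x =
     npair (nfst c) (max (poly_bound P (nsnd c) x) (poly_bound P (poly_mult P (Suc x)) x))"

lemma poly_mult_codes: "poly_mult P m \<in> poly_codes P"
  by (induction P arbitrary: m) auto

lemma poly_val_mult: "poly_val P (poly_mult P m) = omul (opow omega (onat P)) (onat m)"
proof (induction P arbitrary: m)
  case 0
  show ?case by (induction m) auto
qed simp

lemma grz_poly_mult: "2 \<le> k \<Longrightarrow> grz_class k n f \<Longrightarrow> grz_class k n (\<lambda>xs. poly_mult P (f xs))"
  by (cases P) (simp_all add: grz_npair grz_const)

lemma grz_poly_kind: "2 \<le> k \<Longrightarrow> grz_class k n f \<Longrightarrow> grz_class k n (\<lambda>xs. poly_kind P (f xs))"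
  by (induction P arbitrary: f) (simp_all add: grz_if grz_const grz_nfst grz_nsnd)

lemma grz_poly_next:
  "2 \<le> k \<Longrightarrow> grz_class k n f \<Longrightarrow> grz_class k n g \<Longrightarrow> grz_class k n (\<lambda>xs. poly_next P (f xs) (g xs))"
  by (induction P arbitrary: f)
    (simp_all add: grz_if grz_const grz_nfst grz_nsnd grz_poly_kind grz_npair grz_poly_mult grz_Suc
      grz_pred[unfolded One_nat_def])

lemma grz_poly_rank:
  "2 \<le> k \<Longrightarrow> grz_class k n f \<Longrightarrow> grz_class k n g \<Longrightarrow> grz_class k n (\<lambda>xs. poly_rank P (f xs) (g xs))"
  by (induction P arbitrary: f)
    (simp_all add: grz_add grz_nfst grz_nsnd grz_poly_mult grz_Suc grz_mult del: mult_Suc_right)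

lemma grz_poly_bound:
  "2 \<le> k \<Longrightarrow> grz_class k n f \<Longrightarrow> grz_class k n g \<Longrightarrow> grz_class k n (\<lambda>xs. poly_bound P (f xs) (g xs))"
  by (induction P arbitrary: f)
    (simp_all add: grz_max grz_nfst grz_nsnd grz_poly_mult grz_Suc grz_npair)

lemma code_system_poly:
  "code_system k (poly_codes P) (poly_val P) (poly_kind P) (poly_next P) (poly_rank P) (poly_bound P)
     (poly_rank P)"
proof (induction P)
  case 0
  show ?case
  proof
    fix c x :: nat
    show "poly_kind 0 c = 1 \<Longrightarrow> poly_val 0 c = OSuc (poly_val 0 (poly_next 0 c x))"
      by (cases c) auto
  qed (auto split: if_splits intro!: grz_poly_kind grz_poly_next grz_poly_rank grz_poly_bound grz_nth
      simp del: poly_kind.simps poly_next.simps poly_rank.simps poly_bound.simps | auto split: if_splits)+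
next
  case (Suc P)
  then interpret code_system k "poly_codes P" "poly_val P" "poly_kind P" "poly_next P" "poly_rank P"
    "poly_bound P" "poly_rank P" .
  show ?case
  proof
    show "grz_class (Suc (Suc k)) 1 (\<lambda>l. poly_kind (Suc P) (l ! 0))"
      by (intro grz_poly_kind grz_nth) auto
    show "grz_class (Suc (Suc k)) 2 (\<lambda>l. poly_next (Suc P) (l ! 0) (l ! 1))"
      by (intro grz_poly_next grz_nth) auto
    show "grz_class (Suc (Suc k)) 2 (\<lambda>l. poly_rank (Suc P) (l ! 0) (l ! 1))"
      by (intro grz_poly_rank grz_nth) auto
    show "grz_class (Suc (Suc k)) 2 (\<lambda>l. poly_bound (Suc P) (l ! 0) (l ! 1))"
      by (intro grz_poly_bound grz_nth) auto
    fix z x assume "z \<in> poly_codes (Suc P)"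
    then obtain i c where z: "z = npair i c" and c: "c \<in> poly_codes P" by auto
    show "poly_next (Suc P) z x \<in> poly_codes (Suc P)"
      using nx_V[OF c, of x] poly_mult_codes[of P] c by (auto simp: z)
    show "poly_kind (Suc P) z = 0 \<Longrightarrow> poly_val (Suc P) z = OZero"
      using val_zero[OF c] by (auto simp: z split: if_splits)
    show "poly_kind (Suc P) z = 0 \<Longrightarrow> poly_next (Suc P) z x = z"
      by (auto simp: z split: if_splits)
    show "poly_kind (Suc P) z = 1 \<Longrightarrow> poly_val (Suc P) z = OSuc (poly_val (Suc P) (poly_next (Suc P) z x))"
      using val_suc[OF c, of x] by (auto simp: z split: if_splits)
    show "poly_val (Suc P) z = OLim (\<lambda>x. poly_val (Suc P) (poly_next (Suc P) z x))"
      if k2: "poly_kind (Suc P) z = 2"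
    \<comment> \<open>Either the limit is produced by the leading power, and
      \<open>omul_omega\<close> gives its sequence, or it comes from the lower part and addition
      commutes with it.\<close>
    proof (cases "poly_kind P c = 0")
      case True
      with k2 obtain j where i: "i = Suc j" by (cases i) (auto simp: z)
      show ?thesis
        using val_zero[OF c True] by (simp add: z i True omul_omega poly_val_mult)
    next
      case False
      with k2 have "poly_val P c = OLim (\<lambda>x. poly_val P (poly_next P c x))"
        by (intro val_lim[OF c]) (simp add: z)
      then have "poly_val (Suc P) z = oadd (omul (opow omega (onat (Suc P))) (onat i))
          (OLim (\<lambda>x. poly_val P (poly_next P c x)))"
        by (simp add: z)
      then show ?thesis using False by (simp add: z)
    qed
    show "2 < poly_kind (Suc P) z \<Longrightarrow> poly_val (Suc P) (poly_next (Suc P) z x) = poly_val (Suc P) z"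
      using val_silent[OF c, of x] by (auto simp: z split: if_splits)
    show "poly_rank (Suc P) (poly_next (Suc P) z x) x < poly_rank (Suc P) z x"
      if "poly_kind (Suc P) z \<noteq> 0"
    proof (cases "poly_kind P c = 0")
      case True
      with that obtain j where i: "i = Suc j" by (cases i) (auto simp: z)
      show ?thesis by (simp add: z i True)
    next
      case False
      then show ?thesis using rank_less[OF c False, of x] by (simp add: z)
    qed
    show "z \<le> poly_bound (Suc P) z x"
      using code_le[OF c, of x] by (simp add: z npair_mono)
    show "poly_bound (Suc P) (poly_next (Suc P) z x) x \<le> poly_bound (Suc P) z x"
      using M_nx[OF c, of x] by (auto simp: z intro!: npair_mono)
  qed simp
qed

lemma omega_power_poly: "p \<le> P \<Longrightarrow> opow omega (onat p) \<in> poly_val P ` poly_codes P"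
proof (induction rule: dec_induct)
  case base
  have "poly_val p (poly_mult p 1) = opow omega (onat p)"
    by (simp add: poly_val_mult)
  then show ?case using poly_mult_codes[of p 1] by (metis image_eqI)
next
  case (step P)
  then obtain c where "c \<in> poly_codes P" "opow omega (onat p) = poly_val P c" by auto
  then show ?case by (auto intro!: image_eqI[of _ _ "npair 0 c"])
qed

text \<open>Codes \<open>npair 0 c\<close> belong to the first system, codes \<open>npair 1 c\<close> denote \<open>val a + val' c\<close>.\<close>

lemma codable_oadd:
  assumes "code_system k V val kd nx L M r" "code_system k V' val' kd' nx' L' M' r'" and a: "a \<in> V"
  shows "codable k (val ` V \<union> (\<lambda>c. oadd (val a) (val' c)) ` V')"
proof -
  interpret c: code_system k V val kd nx L M r by fact
  interpret c': code_system k V' val' kd' nx' L' M' r' by fact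
  let ?K = "Suc (Suc k)"
  define V2 where "V2 = npair 0 ` V \<union> npair 1 ` V'"
  define val2 where
    "val2 z = (if nfst z = 0 then val (nsnd z) else oadd (val a) (val' (nsnd z)))" for z
  \<comment> \<open>Kind 3 marks the silent passage from \<open>val a\<close> plus zero to the code
    \<open>a\<close> of the left system.\<close>
  define kd2 where "kd2 z = (if nfst z = 0 then kd (nsnd z)
      else if kd' (nsnd z) = 0 then 3 else kd' (nsnd z))" for z
  define nx2 where "nx2 z x = (if nfst z = 0 then npair 0 (nx (nsnd z) x)
      else if kd' (nsnd z) = 0 then npair 0 a else npair 1 (nx' (nsnd z) x))" for z x
  \<comment> \<open>The left summand rests at \<open>a\<close> until the right one is used up: the
    right descent, one passage, then the descent from \<open>a\<close>.\<close>
  define L2 where "L2 z x = (if nfst z = 0 then L (nsnd z) x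
      else L' (nsnd z) x + Suc (L a x))" for z x
  define r2 where "r2 z x = (if nfst z = 0 then r (nsnd z) x
      else r' (nsnd z) x + Suc (r a x))" for z x
  \<comment> \<open>The bound at tag 1 must also cover the codes with tag 0 that follow the passage,
    hence the maximum inside the pair.\<close>
  define M2 where "M2 z x = (if nfst z = 0 then npair 0 (M (nsnd z) x)
      else npair 1 (max (M' (nsnd z) x) (npair 0 (M a x))))" for z x
  have "code_system k V2 val2 kd2 nx2 L2 M2 r2"
  proof
    show "grz_class ?K 1 (\<lambda>l. kd2 (l ! 0))"
      unfolding kd2_def
      by (intro grz_if c.grz_kd' c'.grz_kd' grz_nfst grz_nsnd grz_nth grz_const) auto
    show "grz_class ?K 2 (\<lambda>l. nx2 (l ! 0) (l ! 1))"
      unfolding nx2_def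
      by (intro grz_if grz_npair c'.grz_kd' c.grz_nx' c'.grz_nx' grz_nfst grz_nsnd grz_nth grz_const)
        auto
    show "grz_class ?K 2 (\<lambda>l. L2 (l ! 0) (l ! 1))"
      unfolding L2_def
      by (intro grz_if grz_add grz_Suc c.grz_L' c'.grz_L' grz_nfst grz_nsnd grz_nth grz_const) auto
    show "grz_class ?K 2 (\<lambda>l. M2 (l ! 0) (l ! 1))"
      unfolding M2_def
      by (intro grz_if grz_max grz_npair c.grz_M' c'.grz_M' grz_nfst grz_nsnd grz_nth grz_const) auto
    fix z x assume "z \<in> V2"
    then consider (1) c where "z = npair 0 c" "c \<in> V" | (2) c where "z = npair 1 c" "c \<in> V'"
      by (auto simp: V2_def)
    note cs = this
    note defs = V2_def val2_def kd2_def nx2_def L2_def r2_def M2_def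
    show "nx2 z x \<in> V2"
      using cs by cases (auto simp: defs a c.nx_V c'.nx_V)
    show "kd2 z = 0 \<Longrightarrow> val2 z = OZero"
      using cs by cases (auto simp: defs c.val_zero split: if_splits)
    show "kd2 z = 0 \<Longrightarrow> nx2 z x = z"
      using cs by cases (auto simp: defs c.nx_zero split: if_splits)
    show "val2 z = OSuc (val2 (nx2 z x))" if "kd2 z = 1"
      using cs
    proof cases
      case 1
      then show ?thesis using that c.val_suc[OF 1(2), of x] by (simp add: defs)
    next
      case 2
      then show ?thesis using that c'.val_suc[OF 2(2), of x] by (simp add: defs split: if_splits)
    qed
    show "val2 z = OLim (\<lambda>x. val2 (nx2 z x))" if "kd2 z = 2"
      using cs
    proof cases
      case 1
      then have "val c = OLim (\<lambda>x. val (nx c x))"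
        using that by (intro c.val_lim) (simp_all add: defs)
      then show ?thesis using 1 by (simp add: defs)
    next
      case 2
      then have "kd' c = 2" using that by (simp add: defs split: if_splits)
      moreover have "oadd (val a) (val' c) = oadd (val a) (OLim (\<lambda>x. val' (nx' c x)))"
        using c'.val_lim[OF 2(2) calculation] by simp
      ultimately show ?thesis using 2 by (simp add: defs)
    qed
    show "val2 (nx2 z x) = val2 z" if "2 < kd2 z"
      using cs
    proof cases
      case 1
      then show ?thesis using that c.val_silent[OF 1(2), of x] by (simp add: defs)
    next
      case 2
      then show ?thesis
        using that c'.val_silent[OF 2(2), of x] c'.val_zero[OF 2(2)] by (simp add: defs split: if_splits)
    qed
    show "r2 (nx2 z x) x < r2 z x" if "kd2 z \<noteq> 0"
      using cs
    proof cases
      case 1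
      then show ?thesis using that c.rank_less[OF 1(2), of x] by (simp add: defs)
    next
      case 2
      then show ?thesis using c'.rank_less[OF 2(2), of x] by (simp add: defs)
    qed
    show "r2 z x \<le> L2 z x"
      using cs by cases (auto simp: defs a c.rank_le c'.rank_le intro: add_mono)
    show "z \<le> M2 z x"
      using cs by cases (simp_all add: defs npair_mono c.code_le c'.code_le max.coboundedI1)
    show "M2 (nx2 z x) x \<le> M2 z x"
      using cs
    proof cases
      case 1
      then show ?thesis using c.M_nx[OF 1(2), of x] by (simp add: defs npair_mono)
    next
      case 2
      have "npair 0 (M a x) \<le> npair 1 (max (M' c x) (npair 0 (M a x)))"
        using npair_ge(2)[of "max (M' c x) (npair 0 (M a x))" 1] by simp
      moreover have "npair 1 (max (M' (nx' c x) x) (npair 0 (M a x)))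
          \<le> npair 1 (max (M' c x) (npair 0 (M a x)))"
        using c'.M_nx[OF 2(2), of x] by (intro npair_mono) auto
      ultimately show ?thesis using 2(1) by (simp add: defs)
    qed
  qed
  moreover have "val ` V \<union> (\<lambda>c. oadd (val a) (val' c)) ` V' \<subseteq> val2 ` V2"
  proof
    fix \<alpha> assume "\<alpha> \<in> val ` V \<union> (\<lambda>c. oadd (val a) (val' c)) ` V'"
    then consider c where "c \<in> V" "\<alpha> = val2 (npair 0 c)" | c where "c \<in> V'" "\<alpha> = val2 (npair 1 c)"
      by (auto simp: val2_def)
    then show "\<alpha> \<in> val2 ` V2" by cases (simp_all add: V2_def)
  qed
  ultimately show ?thesis unfolding codable_def by blast
qed

section \<open>Arbitrary sums of finite powers of omega\<close>

lemma codable_mono: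
  assumes "codable k Y" "X \<subseteq> Y"
  shows "codable k X"
proof -
  obtain V val kd nx L M r where "code_system k V val kd nx L M r" "Y \<subseteq> val ` V"
    using assms(1) unfolding codable_def by (elim exE conjE)
  then show ?thesis using order_trans[OF assms(2)] unfolding codable_def by (intro exI conjI)
qed

lemma codable_oadd_omega_power:
  assumes "codable k X" "\<alpha> \<in> X"
  shows "codable k (insert (oadd \<alpha> (opow omega (onat p))) X)"
proof -
  obtain V val kd nx L M r where cs: "code_system k V val kd nx L M r" and X: "X \<subseteq> val ` V"
    using assms(1) unfolding codable_def by (elim exE conjE)
  then obtain a where a: "a \<in> V" "\<alpha> = val a" using assms(2) by blast
  have "insert (oadd \<alpha> (opow omega (onat p))) X
      \<subseteq> val ` V \<union> (\<lambda>c. oadd (val a) (poly_val p c)) ` poly_codes p"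
    using X omega_power_poly[of p p] a(2) by auto
  then show ?thesis
    by (rule codable_mono[OF codable_oadd[OF cs code_system_poly a(1)]])
qed

text \<open>A sum whose powers increase has no list of coefficients, so summands are attached one at
  a time. Carrying an arbitrary left summand \<alpha> through the induction and reassociating leaves
  only single powers to be attached on the right.\<close>

lemma codable_oadd_Psi_omega:
  assumes "\<beta> \<in> Psi_omega" "codable k X" "\<alpha> \<in> X"
  shows "\<exists>Y. X \<subseteq> Y \<and> codable k Y \<and> oadd \<alpha> \<beta> \<in> Y"
  using assms
proof (induction \<beta> arbitrary: \<alpha> X rule: Psi_omega.induct)
  case 1
  then show ?case by (intro exI[of _ X]) simp
next
  case (2 p)
  then show ?case
    by (intro exI[of _ "insert (oadd \<alpha> (opow omega (onat p))) X"] conjI codable_oadd_omega_power) auto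
next
  case (3 \<beta> \<gamma>)
  from "3.IH"(1)[OF "3.prems"] obtain Y where Y: "X \<subseteq> Y" "codable k Y" "oadd \<alpha> \<beta> \<in> Y"
    by (elim exE conjE)
  from "3.IH"(2)[OF Y(2,3)] obtain Z where
    Z: "Y \<subseteq> Z" "codable k Z" "oadd (oadd \<alpha> \<beta>) \<gamma> \<in> Z" by (elim exE conjE)
  show ?case
    by (intro exI[of _ Z] conjI order_trans[OF Y(1) Z(1)] Z(2) Z(3)[unfolded oadd_assoc])
qed

lemma codable_Psi_omega:
  assumes "finite S" "S \<subseteq> Psi_omega"
  shows "codable k S"
proof -
  \<comment> \<open>\<open>OZero\<close> is kept as a left summand, so that each new constant arises
    as 0 + \<beta>.\<close>
  have "\<exists>X. insert OZero S \<subseteq> X \<and> codable k X"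
    using assms
  proof induction
    case empty
    have "{OZero} \<subseteq> poly_val 0 ` poly_codes 0"
      by (auto intro: image_eqI[of _ _ 0])
    with code_system_poly[of k 0] have "codable k {OZero}"
      unfolding codable_def by (intro exI conjI)
    then show ?case by auto
  next
    case (insert \<beta> S)
    then obtain X where X: "insert OZero S \<subseteq> X" "codable k X" by auto
    then obtain Y where "X \<subseteq> Y" "codable k Y" "\<beta> \<in> Y"
      using codable_oadd_Psi_omega[of \<beta> k X OZero] insert.prems by auto
    then show ?case using X by blast
  qed
  then obtain X where "codable k X" "S \<subseteq> X" by blast
  then show ?thesis by (rule codable_mono)
qed

section \<open>Coding the ordinals of positive level\<close>

text \<open>\<open>Add \<beta> i \<gamma>\<close> denotes \<open>\<beta> + \<phi>\<^sub>i(\<gamma>)\<close>. The same type serves for contexts: \<open>Add \<beta> i s\<close>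
  surrounds the hole by \<open>\<beta> + \<phi>\<^sub>i(\<cdot>)\<close> and then by \<open>s\<close>.\<close>

datatype tm = Zero | Add tm nat tm

primrec tval :: "tm \<Rightarrow> cord" where
  "tval Zero = OZero"
| "tval (Add b i g) = oadd (tval b) (veblen i (tval g))"

primrec labels_below :: "nat \<Rightarrow> tm \<Rightarrow> bool" where
  "labels_below k Zero \<longleftrightarrow> True"
| "labels_below k (Add b i g) \<longleftrightarrow> labels_below k b \<and> i < k \<and> labels_below k g"

primrec plug :: "tm \<Rightarrow> tm \<Rightarrow> tm" where
  "plug Zero t = t"
| "plug (Add b i s) t = plug s (Add b i t)"

primrec oplug :: "tm \<Rightarrow> cord \<Rightarrow> cord" where
  "oplug Zero \<alpha> = \<alpha>"
| "oplug (Add b i s) \<alpha> = oplug s (oadd (tval b) (veblen i \<alpha>))"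

lemma tval_plug: "tval (plug s t) = oplug s (tval t)"
  by (induction s arbitrary: t) simp_all

lemma veblen_OLim: "veblen i (OLim \<mu>) = OLim (\<lambda>x. veblen i (\<mu> x))"
  by (cases i) simp_all

text \<open>Addition in its right argument and every phi_i commute with limits even syntactically,
  so a limit in the hole is a limit of the whole. A step therefore acts only near the hole.\<close>

lemma oplug_OLim: "oplug s (OLim \<mu>) = OLim (\<lambda>x. oplug s (\<mu> x))"
  by (induction s arbitrary: \<mu>) (simp_all add: veblen_OLim)

lemma Phi_tval:
  assumes "\<alpha> \<in> Phi k"
  shows "\<exists>t. labels_below k t \<and> tval t = \<alpha>"
  using assms unfolding Phi_def
proof induction
  case 1
  show ?case by (rule exI[of _ Zero]) simp
next
  case (2 \<alpha> \<beta>)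
  then obtain s t where s: "labels_below k s" "tval s = \<alpha>" and t: "labels_below k t" "tval t = \<beta>"
    by blast
  from t(1) have "\<exists>u. labels_below k u \<and> tval u = oadd \<alpha> (tval t)"
  proof (induction t)
    case Zero
    then show ?case using s by auto
  next
    case (Add b i g)
    then obtain u where "labels_below k u" "tval u = oadd \<alpha> (tval b)" by auto
    then show ?case using Add.prems by (intro exI[of _ "tm.Add u i g"]) (simp add: oadd_assoc)
  qed
  then show ?case using t by simp
next
  case (3 i \<alpha>)
  then obtain t where "labels_below k t" "tval t = \<alpha>" by blast
  then show ?case using 3 by (intro exI[of _ "Add Zero i t"]) simp
qed

subsection \<open>Descent on pairs of a term and a context\<close>

abbreviation wrap :: "nat \<Rightarrow> nat \<Rightarrow> tm \<Rightarrow> tm" where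
  "wrap j n \<equiv> (Add Zero j ^^ n)"

abbreviation add_mult :: "tm \<Rightarrow> nat \<Rightarrow> tm \<Rightarrow> tm" where
  "add_mult b n \<equiv> ((\<lambda>u. Add u 0 b) ^^ n)"

fun tkind :: "tm \<Rightarrow> tm \<Rightarrow> nat" where
  "tkind (Add b i g) s = 3"
| "tkind Zero Zero = 0"
| "tkind Zero (Add b 0 Zero) = 1"
| "tkind Zero (Add b i s) = 2"

text \<open>A term in focus is opened at its rightmost part. With \<open>Zero\<close> in focus, a
  frame \<open>Add b 0\<close> reads b + 1 and a frame \<open>Add b (Suc j)\<close> ends in
  phi_{j+1}(0), so the innermost one or two frames determine the reduction. An x-fold iterate of
  phi_j needs only \<open>x - 1\<close> wraps because its outermost copy carries the left summand;
  for x = 0 no copy exists. In the case of \<omega> to the power b + 1, x copies go into the context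
  and one more stays at the hole, x + 1 in all.\<close>

fun tnext :: "tm \<Rightarrow> tm \<Rightarrow> nat \<Rightarrow> tm \<times> tm" where
  "tnext (Add b i g) s x = (g, Add b i s)"
| "tnext Zero Zero x = (Zero, Zero)"
| "tnext Zero (Add b 0 Zero) x = (b, Zero)"
| "tnext Zero (Add b (Suc j) s) x =
     (if x = 0 then (b, s) else (Zero, wrap j (x - 1) (Add b j s)))"
| "tnext Zero (Add b 0 (Add b' 0 s)) x = (b, Add (add_mult b x b') 0 s)"
| "tnext Zero (Add b 0 (Add b' (Suc j) s)) x =
     (if x = 0 then (Zero, Add (Add b' (Suc j) b) 0 s)
      else (Zero, Add (Add Zero (Suc j) b) 0 (wrap j (x - 1) (Add b' j s))))"

lemma plug_wrap: "plug (wrap j n s) t = plug s (wrap j n t)"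
  by (induction n arbitrary: s t) (simp_all add: funpow_swap1)

lemma labels_below_wrap: "j < k \<Longrightarrow> labels_below k s \<Longrightarrow> labels_below k (wrap j n s)"
  by (induction n) simp_all

lemma labels_below_add_mult:
  "labels_below k b \<Longrightarrow> 0 < k \<Longrightarrow> labels_below k b' \<Longrightarrow> labels_below k (add_mult b n b')"
  by (induction n) simp_all

lemma tval_wrap: "tval (wrap j n t) = (veblen j ^^ n) (tval t)"
  by (induction n) simp_all

lemma tval_add_mult:
  "tval (add_mult b n b') = oadd (tval b') (omul (opow omega (tval b)) (onat n))"
  by (induction n) (simp_all add: oadd_assoc)

lemma labels_below_tnext:
  "0 < k \<Longrightarrow> labels_below k t \<Longrightarrow> labels_below k s \<Longrightarrow>
    labels_below k (fst (tnext t s x)) \<and> labels_below k (snd (tnext t s x))"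
  by (induction t s x rule: tnext.induct) (auto simp: labels_below_wrap labels_below_add_mult)

lemma plug_tnext_silent: "tkind t s = 3 \<Longrightarrow> plug (snd (tnext t s x)) (fst (tnext t s x)) = plug s t"
  by (cases "(t, s)" rule: tkind.cases) auto

lemma tval_tnext_suc:
  "tkind t s = 1 \<Longrightarrow>
    tval (plug s t) = OSuc (tval (plug (snd (tnext t s x)) (fst (tnext t s x))))"
  by (cases "(t, s)" rule: tkind.cases) auto

text \<open>The limits stem from phi_{j+1}(0), from \<omega> to a successor power, and from
  phi_{j+1} at a successor. The sequence is computed at the hole and carried outward by
  \<open>oplug_OLim\<close>.\<close>

lemma tval_tnext_lim:
  assumes "tkind t s = 2"
  shows "tval (plug s t) = OLim (\<lambda>x. tval (plug (snd (tnext t s x)) (fst (tnext t s x))))"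
proof -
  from assms have t: "t = Zero" by (cases t) auto
  with assms obtain b i s1 where s: "s = Add b i s1" by (cases s) auto
  consider (1) j where "i = Suc j" | (2) b' s' where "i = 0" "s1 = Add b' 0 s'"
    | (3) b' j s' where "i = 0" "s1 = Add b' (Suc j) s'"
  proof (cases i)
    case 0
    with assms t s obtain b' i' s' where "s1 = Add b' i' s'" by (cases s1) auto
    then show ?thesis using 0 2 3 by (cases i') auto
  qed blast
  then show ?thesis
  proof cases
    case 1
    have "tval (plug (snd (tnext t s x)) (fst (tnext t s x)))
        = oplug s1 (oadd (tval b) ((veblen j ^^ x) OZero))" for x
      using 1 t s by (cases x) (simp_all add: plug_wrap tval_plug tval_wrap)
    then show ?thesis using 1 t s by (simp add: tval_plug oplug_OLim)
  next
    case 2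
    have "tval (plug (snd (tnext t s x)) (fst (tnext t s x)))
        = oplug s' (oadd (tval b') (omul (opow omega (tval b)) (onat (Suc x))))" for x
      using 2 t s by (simp add: tval_plug tval_add_mult oadd_assoc)
    moreover have "tval (plug s t) = oplug s' (oadd (tval b') (opow omega (OSuc (tval b))))"
      using 2 t s by (simp add: tval_plug)
    ultimately show ?thesis by (simp add: omul_omega oplug_OLim)
  next
    case 3
    have "tval (plug (snd (tnext t s x)) (fst (tnext t s x)))
        = oplug s' (oadd (tval b') ((veblen j ^^ x) (OSuc (veblen (Suc j) (tval b)))))" for x
      using 3 t s by (cases x) (simp_all add: plug_wrap tval_plug tval_wrap)
    then show ?thesis using 3 t s by (simp add: tval_plug oplug_OLim)
  qed
qed

lemma tkind_zero: "tkind t s = 0 \<Longrightarrow> t = Zero \<and> s = Zero"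
  by (cases "(t, s)" rule: tkind.cases) auto

subsection \<open>Termination measure\<close>

text \<open>\<open>grow i N\<close> majorizes the slow-growing counterpart of \<open>\<phi>\<^sub>i\<close> when all limits are resolved
  with indices up to \<open>N\<close>.\<close>

primrec grow :: "nat \<Rightarrow> nat \<Rightarrow> nat \<Rightarrow> nat" where
  "grow 0 N m = (N + 2) ^ m"
| "grow (Suc i) N m = (grow i N ^^ ((N + 2) * (m + 1))) 0"

lemma funpow_less_exponent:
  fixes f :: "nat \<Rightarrow> nat"
  assumes "\<And>x. x < f x" "m < m'"
  shows "(f ^^ m) x < (f ^^ m') x"
  using funpow_mono_exponent[of f "Suc m" m' x] assms by (auto intro: order.strict_trans2)

lemma grow_greater: "m < grow i N m"
proof (induction i arbitrary: m)
  case 0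
  show ?case
  proof (induction m)
    case (Suc m)
    then have "Suc m < 2 * (N + 2) ^ m" by simp
    also have "\<dots> \<le> (N + 2) * (N + 2) ^ m" by (intro mult_le_mono1) simp
    finally show ?case by simp
  qed simp
next
  case (Suc i)
  show ?case using funpow_inflationary[of "grow i N" 0 "(N + 2) * (m + 1)"] Suc by simp
qed

lemma grow_strict_mono: "strict_mono (grow i N)"
proof (cases i)
  case 0
  then show ?thesis by (auto simp: strict_mono_def intro: power_strict_increasing)
next
  case (Suc j)
  show ?thesis unfolding strict_mono_def Suc grow.simps
  proof (intro allI impI)
    fix m m' :: nat assume "m < m'"
    then show "(grow j N ^^ ((N + 2) * (m + 1))) 0 < (grow j N ^^ ((N + 2) * (m' + 1))) 0"
      by (intro funpow_less_exponent grow_greater mult_less_mono2) auto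
  qed
qed

lemma grow_Suc_0: "x \<le> N \<Longrightarrow> (grow j N ^^ x) 0 < grow (Suc j) N 0"
  unfolding grow.simps by (intro funpow_less_exponent grow_greater) simp

text \<open>Raising the argument by 1 provides \<open>N + 2\<close> further iterations: at most
  \<open>N\<close> are spent on the limit, one on the added 1, and one yields strictness.\<close>

lemma grow_Suc_Suc:
  assumes "x \<le> N"
  shows "(grow j N ^^ x) (Suc (grow (Suc j) N m)) < grow (Suc j) N (Suc m)"
proof -
  let ?f = "grow j N" and ?E = "grow (Suc j) N m"
  have "(?f ^^ x) (Suc ?E) < (?f ^^ Suc N) (Suc ?E)"
    using assms by (intro funpow_less_exponent grow_greater) simp
  also have "\<dots> \<le> (?f ^^ Suc N) (?f ?E)"
    using grow_greater[of ?E j N] by (intro funpow_mono strict_mono_mono grow_strict_mono) simp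
  also have "\<dots> = (?f ^^ (N + 2)) ?E" by (simp add: funpow_swap1)
  also have "\<dots> = (?f ^^ (N + 2 + (N + 2) * (m + 1))) 0" unfolding funpow_add by simp
  also have "\<dots> = grow (Suc j) N (Suc m)" by simp
  finally show ?thesis .
qed

primrec weight :: "nat \<Rightarrow> tm \<Rightarrow> nat" where
  "weight N Zero = 0"
| "weight N (Add b i g) = weight N b + grow i N (weight N g)"

primrec tsize :: "tm \<Rightarrow> nat" where
  "tsize Zero = 0"
| "tsize (Add b i g) = Suc (tsize b + tsize g)"

lemma tsize_le_weight: "tsize t \<le> weight N t"
proof (induction t)
  case (Add b i g)
  then show ?case using grow_greater[of "weight N g" i N] by simp
qed simp

lemma tsize_plug: "tsize (plug s t) = tsize s + tsize t"
  by (induction s arbitrary: t) simp_all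

lemma weight_plug_less: "weight N t < weight N t' \<Longrightarrow> weight N (plug s t) < weight N (plug s t')"
  by (induction s arbitrary: t t') (simp_all add: strict_mono_less[OF grow_strict_mono])

lemma weight_wrap: "weight N (wrap j n t) = (grow j N ^^ n) (weight N t)"
  by (induction n) simp_all

lemma weight_add_mult: "weight N (add_mult b n b') = weight N b' + n * grow 0 N (weight N b)"
  by (induction n) simp_all

text \<open>By \<open>plug_wrap\<close> the new frames can be counted to the term instead of the
  context. Both sides then share one context, and by \<open>weight_plug_less\<close> only the
  contents of the hole need comparison.\<close>

lemma weight_tnext_less:
  assumes "x \<le> N" "tkind t s \<noteq> 0" "tkind t s \<noteq> 3"
  shows "weight N (plug (snd (tnext t s x)) (fst (tnext t s x))) < weight N (plug s t)"
  using assms(2,3)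
proof (cases "(t, s, x)" rule: tnext.cases)
  case (4 b j s1 x')
  have "weight N (plug s1 (if x = 0 then b else Add b j (wrap j (x - 1) Zero)))
      < weight N (plug s1 (Add b (Suc j) Zero))"
  proof (intro weight_plug_less)
    show "weight N (if x = 0 then b else Add b j (wrap j (x - 1) Zero))
        < weight N (Add b (Suc j) Zero)"
      using grow_Suc_0[OF assms(1), of j]
      by (cases x) (simp_all add: weight_wrap del: grow.simps)
  qed
  then show ?thesis using 4 by (simp add: plug_wrap split: if_splits)
next
  case (5 b b' s1 x')
  have "weight N (plug s1 (Add (add_mult b x b') 0 b))
      < weight N (plug s1 (Add b' 0 (Add b 0 Zero)))"
  proof (intro weight_plug_less)
    \<comment> \<open>The x + 1 copies of weight \<open>e\<close> stay below the base
      \<open>N + 2\<close> times \<open>e\<close>.\<close>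
    define e where "e = (N + 2) ^ weight N b"
    have "x * e \<le> N * e" using assms(1) by (intro mult_le_mono1)
    moreover have "0 < e" by (simp add: e_def)
    ultimately have "x * e + e < (N + 2) * e" unfolding add_mult_distrib by linarith
    then show "weight N (Add (add_mult b x b') 0 b) < weight N (Add b' 0 (Add b 0 Zero))"
      unfolding weight.simps weight_add_mult grow.simps e_def by simp
  qed
  then show ?thesis using 5 by simp
next
  case (6 b b' j s1 x')
  have "weight N (plug s1 (if x = 0 then Add (Add b' (Suc j) b) 0 Zero
        else Add b' j (wrap j (x - 1) (Add (Add Zero (Suc j) b) 0 Zero))))
      < weight N (plug s1 (Add b' (Suc j) (Add b 0 Zero)))"
  proof (intro weight_plug_less)
    show "weight N (if x = 0 then Add (Add b' (Suc j) b) 0 Zero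
        else Add b' j (wrap j (x - 1) (Add (Add Zero (Suc j) b) 0 Zero)))
        < weight N (Add b' (Suc j) (Add b 0 Zero))"
      using grow_Suc_Suc[OF assms(1), of j "weight N b"]
      by (cases x) (simp_all add: weight_wrap del: grow.simps(2))
  qed
  then show ?thesis using 6 by (simp add: plug_wrap split: if_splits)
qed auto

subsection \<open>Arithmetization\<close>

lemma grz_lift3:
  assumes "grz_class k 3 (\<lambda>l. F (l ! 0) (l ! 1) (l ! 2))"
    and "grz_class k n f" "grz_class k n g" "grz_class k n h"
  shows "grz_class k n (\<lambda>xs. F (f xs) (g xs) (h xs))"
proof -
  have "grz_class k n (\<lambda>xs. (\<lambda>l. F (l ! 0) (l ! 1) (l ! 2)) [f xs, g xs, h xs])"
    by (rule grz_compose[OF assms(1)])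
      (use grz_list_Cons[OF assms(2) grz_list_Cons[OF assms(3) grz_list_Cons[OF assms(4) grz_list_Nil]]]
        in \<open>simp add: numeral_3_eq_3\<close>)
  then show ?thesis by (simp add: numeral_2_eq_2)
qed

definition nadd :: "nat \<Rightarrow> nat \<Rightarrow> nat \<Rightarrow> nat" where "nadd b i g = Suc (npair b (npair i g))"
definition nleft :: "nat \<Rightarrow> nat" where "nleft z = nfst (z - 1)"
definition nlabel :: "nat \<Rightarrow> nat" where "nlabel z = nfst (nsnd (z - 1))"
definition nright :: "nat \<Rightarrow> nat" where "nright z = nsnd (nsnd (z - 1))"

lemma nadd_simps [simp]:
  "nleft (nadd b i g) = b" "nlabel (nadd b i g) = i" "nright (nadd b i g) = g" "nadd b i g \<noteq> 0"
  by (simp_all add: nadd_def nleft_def nlabel_def nright_def)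

lemma grz_nadd:
  "2 \<le> k \<Longrightarrow> grz_class k n f \<Longrightarrow> grz_class k n g \<Longrightarrow> grz_class k n h \<Longrightarrow>
    grz_class k n (\<lambda>xs. nadd (f xs) (g xs) (h xs))"
  unfolding nadd_def by (intro grz_Suc grz_npair)

lemma grz_nleft: "2 \<le> k \<Longrightarrow> grz_class k n f \<Longrightarrow> grz_class k n (\<lambda>xs. nleft (f xs))"
  unfolding nleft_def by (intro grz_nfst grz_pred)

lemma grz_nlabel: "2 \<le> k \<Longrightarrow> grz_class k n f \<Longrightarrow> grz_class k n (\<lambda>xs. nlabel (f xs))"
  unfolding nlabel_def by (intro grz_nfst grz_nsnd grz_pred)

lemma grz_nright: "2 \<le> k \<Longrightarrow> grz_class k n f \<Longrightarrow> grz_class k n (\<lambda>xs. nright (f xs))"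
  unfolding nright_def by (intro grz_nsnd grz_pred)

definition nwrap :: "nat \<Rightarrow> nat \<Rightarrow> nat \<Rightarrow> nat" where "nwrap j n s = (nadd 0 j ^^ n) s"
definition nadd_mult :: "nat \<Rightarrow> nat \<Rightarrow> nat \<Rightarrow> nat" where
  "nadd_mult b n u = ((\<lambda>u. nadd u 0 b) ^^ n) u"

text \<open>Pairing is quadratic, so iterating it leads out of the polynomials. Level 3 is what
  \<open>grz_funpow\<close> gives from level 2, and it is available as soon as k is
  positive.\<close>

lemma grz_nwrap:
  assumes "3 \<le> k" "grz_class k n f" "grz_class k n g" "grz_class k n h"
  shows "grz_class k n (\<lambda>xs. nwrap (f xs) (g xs) (h xs))"
proof (rule grz_lift3[OF _ assms(2-4)])
  have "grz_class (Suc (Suc (Suc 0))) 3 (\<lambda>xs. ((\<lambda>u. nadd 0 (xs ! 0) u) ^^ (xs ! 1)) (xs ! 2))"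
    by (rule grz_funpow[where f = "\<lambda>u xs. nadd 0 (xs ! 0) u"];
        intro grz_nadd grz_const grz_nth grz_tl[where f = "\<lambda>xs. xs ! 0"]) auto
  then show "grz_class k 3 (\<lambda>l. nwrap (l ! 0) (l ! 1) (l ! 2))"
    unfolding nwrap_def using assms(1) by (auto intro: grz_mono)
qed

lemma grz_nadd_mult:
  assumes "3 \<le> k" "grz_class k n f" "grz_class k n g" "grz_class k n h"
  shows "grz_class k n (\<lambda>xs. nadd_mult (f xs) (g xs) (h xs))"
proof (rule grz_lift3[OF _ assms(2-4)])
  have "grz_class (Suc (Suc (Suc 0))) 3 (\<lambda>xs. ((\<lambda>u. nadd u 0 (xs ! 0)) ^^ (xs ! 1)) (xs ! 2))"
    by (rule grz_funpow[where f = "\<lambda>u xs. nadd u 0 (xs ! 0)"];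
        intro grz_nadd grz_const grz_nth grz_tl[where f = "\<lambda>xs. xs ! 0"]) auto
  then show "grz_class k 3 (\<lambda>l. nadd_mult (l ! 0) (l ! 1) (l ! 2))"
    unfolding nadd_mult_def using assms(1) by (auto intro: grz_mono)
qed

primrec enc :: "tm \<Rightarrow> nat" where
  "enc Zero = 0"
| "enc (Add b i g) = nadd (enc b) i (enc g)"

lemma enc_inject: "enc s = enc t \<Longrightarrow> s = t"
proof (induction s arbitrary: t)
  case Zero
  then show ?case by (cases t) (use nadd_simps(4) in auto)
next
  case (Add b i g)
  then obtain b' i' g' where t: "t = tm.Add b' i' g'" by (cases t) auto
  have "enc b = enc b'" "i = i'" "enc g = enc g'"
    using arg_cong[OF Add.prems, of nleft] arg_cong[OF Add.prems, of nlabel]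
      arg_cong[OF Add.prems, of nright] t by simp_all
  then show ?case using Add.IH t by simp
qed

lemma enc_eq_0 [simp]: "enc t = 0 \<longleftrightarrow> t = Zero"
  by (cases t) auto

lemma enc_wrap: "enc (wrap j n s) = nwrap j n (enc s)"
  unfolding nwrap_def by (induction n) simp_all

lemma enc_add_mult: "enc (add_mult b n u) = nadd_mult (enc b) n (enc u)"
  unfolding nadd_mult_def by (induction n) simp_all

text \<open>Like the two functions after it, this spells out the recursion-free cases of the descent
  on codes; the \<open>if\<close> cascades look only at the tops of the focused term and its
  context.\<close>

definition nkind :: "nat \<Rightarrow> nat \<Rightarrow> nat" where
  "nkind t s = (if t = 0 then if s = 0 then 0
     else if nlabel s = 0 then if nright s = 0 then 1 else 2 else 2 else 3)"

definition nnext_term :: "nat \<Rightarrow> nat \<Rightarrow> nat \<Rightarrow> nat" where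
  "nnext_term t s x = (if t = 0 then if s = 0 then 0
     else if nlabel s = 0 then if nright s = 0 then nleft s
       else if nlabel (nright s) = 0 then nleft s else 0
     else if x = 0 then nleft s else 0 else nright t)"

definition nnext_context :: "nat \<Rightarrow> nat \<Rightarrow> nat \<Rightarrow> nat" where
  "nnext_context t s x = (if t = 0 then if s = 0 then 0
     else if nlabel s = 0 then if nright s = 0 then 0
       else if nlabel (nright s) = 0
         then nadd (nadd_mult (nleft s) x (nleft (nright s))) 0 (nright (nright s))
       else if x = 0
         then nadd (nadd (nleft (nright s)) (nlabel (nright s)) (nleft s)) 0 (nright (nright s))
       else nadd (nadd 0 (nlabel (nright s)) (nleft s)) 0
         (nwrap (nlabel (nright s) - 1) (x - 1)
           (nadd (nleft (nright s)) (nlabel (nright s) - 1) (nright (nright s))))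
     else if x = 0 then nright s
     else nwrap (nlabel s - 1) (x - 1) (nadd (nleft s) (nlabel s - 1) (nright s))
     else nadd (nleft t) (nlabel t) s)"

lemma nkind_enc: "nkind (enc t) (enc s) = tkind t s"
  by (cases "(t, s)" rule: tkind.cases) (simp_all add: nkind_def)

lemma nnext_term_enc: "nnext_term (enc t) (enc s) x = enc (fst (tnext t s x))"
  by (cases "(t, s, x)" rule: tnext.cases) (simp_all add: nnext_term_def)

lemma nnext_context_enc: "nnext_context (enc t) (enc s) x = enc (snd (tnext t s x))"
  by (cases "(t, s, x)" rule: tnext.cases)
    (simp_all add: nnext_context_def enc_wrap enc_add_mult)

lemma grz_nkind:
  assumes "3 \<le> k" "grz_class k n t" "grz_class k n s"
  shows "grz_class k n (\<lambda>xs. nkind (t xs) (s xs))"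
  unfolding nkind_def
  by (intro grz_if grz_nlabel grz_nright grz_const assms) (use assms(1) in simp_all)

lemma grz_nnext_term:
  assumes "3 \<le> k" "grz_class k n t" "grz_class k n s" "grz_class k n x"
  shows "grz_class k n (\<lambda>xs. nnext_term (t xs) (s xs) (x xs))"
  unfolding nnext_term_def
  by (intro grz_if grz_nlabel grz_nright grz_nleft grz_const assms) (use assms(1) in simp_all)

lemma grz_nnext_context:
  assumes "3 \<le> k" "grz_class k n t" "grz_class k n s" "grz_class k n x"
  shows "grz_class k n (\<lambda>xs. nnext_context (t xs) (s xs) (x xs))"
  unfolding nnext_context_def
  by (intro grz_if grz_nadd grz_nwrap grz_nadd_mult grz_nlabel grz_nright grz_nleft grz_pred grz_const
      assms) (use assms(1) in simp_all)

text \<open>Powers are iterated multiplication, which places the base case in class 3; each further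
  label is one use of \<open>grz_funpow\<close>.\<close>

lemma grz_grow:
  "grz_class (i + 3) 2 (\<lambda>l. grow i (l ! 0) (l ! 1))"
proof (induction i)
  case 0
  have "grz_class (Suc (Suc (Suc 0))) 2 (\<lambda>xs. ((\<lambda>u. (xs ! 0 + 2) * u) ^^ (xs ! 1)) 1)"
    by (rule grz_funpow[where f = "\<lambda>u xs. (xs ! 0 + 2) * u"];
        intro grz_mult grz_add grz_const grz_nth grz_tl[where f = "\<lambda>xs. xs ! 0"]) auto
  moreover have "((\<lambda>u. c * u) ^^ m) 1 = c ^ m" for c m :: nat
    by (induction m) simp_all
  ultimately have "grz_class (Suc (Suc (Suc 0))) 2 (\<lambda>xs. (xs ! 0 + 2) ^ (xs ! 1))" by (simp only:)
  then show ?case by (simp add: numeral_3_eq_3)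
next
  case (Suc i)
  have "grz_class (Suc (Suc (Suc i))) (Suc 2) (\<lambda>l. grow i (tl l ! 0) (l ! 0))"
  proof (rule grz_lift2[where F = "grow i"])
    show "grz_class (Suc (Suc (Suc i))) 2 (\<lambda>l. grow i (l ! 0) (l ! 1))"
      using Suc by (simp add: numeral_3_eq_3)
  qed (intro grz_tl[where f = "\<lambda>xs. xs ! 0"] grz_nth; simp)+
  then have "grz_class (Suc (Suc (Suc (Suc i)))) 2
      (\<lambda>xs. ((\<lambda>u. grow i (xs ! 0) u) ^^ ((xs ! 0 + 2) * (xs ! 1 + 1))) 0)"
    by (rule grz_funpow[where f = "\<lambda>u xs. grow i (xs ! 0) u"];
        intro grz_mult grz_add grz_const grz_nth) auto
  then show ?case by (simp add: numeral_3_eq_3)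
qed

text \<open>The term is fixed and only the index varies, so this is a finite composition of
  functions \<open>grow i\<close> with i + 3 at most k + 2.\<close>

lemma grz_weight:
  assumes "labels_below k t" "grz_class (Suc (Suc k)) n f"
  shows "grz_class (Suc (Suc k)) n (\<lambda>xs. weight (f xs) t)"
  using assms(1)
proof (induction t)
  case Zero
  then show ?case by (simp add: grz_const)
next
  case (Add b i g)
  then have "grz_class (Suc (Suc k)) 2 (\<lambda>l. grow i (l ! 0) (l ! 1))"
    by (intro grz_mono[OF grz_grow]) simp
  then have "grz_class (Suc (Suc k)) n (\<lambda>xs. grow i (f xs) (weight (f xs) g))"
    by (rule grz_lift2) (use assms(2) Add in simp_all)
  then show ?case using Add by (simp add: grz_add)
qed

definition code_bound :: "nat \<Rightarrow> nat \<Rightarrow> nat" where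
  "code_bound k n = ((\<lambda>w. nadd w w w) ^^ n) k"

lemma nadd_mono: "b \<le> b' \<Longrightarrow> i \<le> i' \<Longrightarrow> g \<le> g' \<Longrightarrow> nadd b i g \<le> nadd b' i' g'"
  unfolding nadd_def by (simp add: npair_mono)

lemma code_bound_mono: "m \<le> n \<Longrightarrow> code_bound k m \<le> code_bound k n"
  unfolding code_bound_def
  by (rule funpow_mono_exponent) (auto simp: nadd_def less_Suc_eq_le npair_ge)

text \<open>Each constructor costs one round of \<open>code_bound\<close>, and the start value
  \<open>k\<close> dominates the labels.\<close>

lemma enc_le_code_bound: "labels_below k t \<Longrightarrow> enc t \<le> code_bound k (tsize t)"
proof (induction t)
  case (Add b i g)
  let ?w = "code_bound k (tsize b + tsize g)"
  have "enc b \<le> ?w" "enc g \<le> ?w"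
    using Add code_bound_mono[of "tsize b" "tsize b + tsize g" k]
      code_bound_mono[of "tsize g" "tsize b + tsize g" k] by auto
  moreover have "i \<le> ?w"
    using Add.prems code_bound_mono[of 0 "tsize b + tsize g" k] by (simp add: code_bound_def)
  ultimately have "enc (tm.Add b i g) \<le> nadd ?w ?w ?w" by (simp add: nadd_mono)
  then show ?case by (simp add: code_bound_def)
qed simp

lemma grz_code_bound:
  assumes "3 \<le> k" "grz_class k n f"
  shows "grz_class k n (\<lambda>xs. code_bound c (f xs))"
proof (rule grz_lift1[OF _ assms(2)])
  have "grz_class (Suc (Suc (Suc 0))) 1 (\<lambda>xs. ((\<lambda>w. nadd w w w) ^^ (xs ! 0)) c)"
    by (rule grz_funpow[where f = "\<lambda>w xs. nadd w w w"]; intro grz_nadd grz_const grz_nth) auto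
  then show "grz_class k 1 (\<lambda>l. code_bound c (l ! 0))"
    unfolding code_bound_def using assms(1) by (auto intro: grz_mono)
qed

text \<open>The code of a state also records the largest index used so far: beyond that index
  the weight stays below that of the given constants.\<close>

lemma codable_terms:
  assumes k: "1 \<le> k" and ts: "\<And>t. t \<in> set ts \<Longrightarrow> labels_below k t"
  shows "codable k (tval ` set ts)"
proof -
  let ?K = "Suc (Suc k)"
  \<comment> \<open>Weights are computed in the class for the given constants only; codes met in a
    descent are compared with \<open>T\<close> in the proof.\<close>
  define T where "T N = sum_list (map (weight N) ts)" for N
  define st where "st y t s = npair y (npair (enc t) (enc s))" for y t s
  define V where "V = {st y t s | y t s. labels_below k t \<and> labels_below k s \<and>
      (\<forall>N\<ge>y. weight N (plug s t) \<le> T N)}"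
  define idx where "idx z x = max (nfst z) x" for z x
  define tc where "tc z = nfst (nsnd z)" for z
  define sc where "sc z = nsnd (nsnd z)" for z
  define val where "val z = tval (plug (inv enc (sc z)) (inv enc (tc z)))" for z
  define kd where "kd z = nkind (tc z) (sc z)" for z
  \<comment> \<open>At kind 0 the recorded index must stay as well, or \<open>nx_zero\<close> would
    fail.\<close>
  define nx where "nx z x = (if kd z = 0 then z
      else npair (idx z x) (npair (nnext_term (tc z) (sc z) x) (nnext_context (tc z) (sc z) x)))" for z x
  define L where "L z x = T (idx z x) * T (idx z x) + T (idx z x)" for z x
  define M where "M z x = npair (idx z x)
      (npair (code_bound k (T (idx z x))) (code_bound k (T (idx z x))))" for z x
  define wt where "wt z x = weight (idx z x) (plug (inv enc (sc z)) (inv enc (tc z)))" for z x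
  \<comment> \<open>Silent steps keep the weight and shrink the focused term. Other steps lower the
    weight from w to some w', the new focused term has size at most w', and w' * w' + w' is below w
    * w.\<close>
  define r where "r z x = wt z x * wt z x + tsize (inv enc (tc z))" for z x

  have inv: "inv enc (enc t) = t" for t
    by (rule inv_f_f) (auto intro: injI enc_inject)
  have st: "nfst (st y t s) = y" "tc (st y t s) = enc t" "sc (st y t s) = enc s" for y t s
    by (simp_all add: st_def tc_def sc_def)
  have kd_st: "kd (st y t s) = tkind t s" for y t s
    by (simp add: kd_def st nkind_enc)
  have val_st: "val (st y t s) = tval (plug s t)" for y t s
    by (simp add: val_def st inv)
  have nx_st: "nx (st y t s) x = st (max y x) (fst (tnext t s x)) (snd (tnext t s x))"
    if "tkind t s \<noteq> 0" for y t s x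
    using that unfolding nx_def kd_st
    by (simp add: st idx_def nnext_term_enc nnext_context_enc st_def[of "max y x"])
  have wt_st: "wt (st y t s) x = weight (max y x) (plug s t)" for y t s x
    by (simp add: wt_def st idx_def inv)
  have r_st: "r (st y t s) x = wt (st y t s) x * wt (st y t s) x + tsize t" for y t s x
    by (simp add: r_def st inv)
  have weight_le: "weight N (plug (snd (tnext t s x)) (fst (tnext t s x))) \<le> weight N (plug s t)"
    if "x \<le> N" "tkind t s \<noteq> 0" for N t s x
  proof (cases "tkind t s = 3")
    case True then show ?thesis by (simp add: plug_tnext_silent)
  next
    case False then show ?thesis using weight_tnext_less[OF that False] by simp
  qed

  have gT: "grz_class ?K n (\<lambda>xs. T (f xs))" if "grz_class ?K n f" for n f
    unfolding T_def by (intro grz_sum_list[OF grz_list_map] grz_weight ts that)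
  have gidx: "grz_class ?K 2 (\<lambda>l. idx (l ! 0) (l ! 1))"
    unfolding idx_def by (intro grz_max grz_nfst grz_nth) auto
  have gtc: "grz_class ?K (Suc n) (\<lambda>l. tc (l ! 0))" and gsc: "grz_class ?K (Suc n) (\<lambda>l. sc (l ! 0))"
    for n
    unfolding tc_def sc_def by (intro grz_nfst grz_nsnd grz_nth; simp)+
  have gkd: "grz_class ?K (Suc n) (\<lambda>l. kd (l ! 0))" for n
    unfolding kd_def by (intro grz_nkind gtc gsc) (use k in simp)

  have "code_system k V val kd nx L M r"
  proof
    show "grz_class ?K 1 (\<lambda>l. kd (l ! 0))" using gkd[of 0] by simp
    show "grz_class ?K 2 (\<lambda>l. nx (l ! 0) (l ! 1))"
      unfolding nx_def
      by (intro grz_if grz_npair grz_nnext_term grz_nnext_context gidx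
          gtc[of 1, unfolded Suc_1] gsc[of 1, unfolded Suc_1] gkd[of 1, unfolded Suc_1] grz_nth)
        (use k in simp_all)
    show "grz_class ?K 2 (\<lambda>l. L (l ! 0) (l ! 1))"
      unfolding L_def by (intro grz_add grz_mult gT gidx) simp
    show "grz_class ?K 2 (\<lambda>l. M (l ! 0) (l ! 1))"
      unfolding M_def by (intro grz_npair grz_code_bound gT gidx) (use k in simp_all)
    fix z x assume "z \<in> V"
    then obtain y t s where z: "z = st y t s" and lt: "labels_below k t" and ls: "labels_below k s"
      and wN: "\<And>N. y \<le> N \<Longrightarrow> weight N (plug s t) \<le> T N"
      unfolding V_def by blast
    show "nx z x \<in> V"
    proof (cases "tkind t s = 0")
      case True
      then show ?thesis using \<open>z \<in> V\<close> by (simp add: nx_def z kd_st)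
    next
      case False
      have "weight N (plug (snd (tnext t s x)) (fst (tnext t s x))) \<le> T N" if "max y x \<le> N" for N
        using order_trans[OF weight_le wN, of x N] False that by simp
      then show ?thesis
        using labels_below_tnext[OF _ lt ls, of x] k unfolding V_def z nx_st[OF False]
        by (intro CollectI exI[of _ "max y x"] exI[of _ "fst (tnext t s x)"]
            exI[of _ "snd (tnext t s x)"]) auto
    qed
    show "kd z = 0 \<Longrightarrow> val z = OZero"
      using tkind_zero[of t s] by (simp add: z kd_st val_st)
    show "kd z = 0 \<Longrightarrow> nx z x = z" by (simp add: nx_def)
    show "kd z = 1 \<Longrightarrow> val z = OSuc (val (nx z x))"
      using tval_tnext_suc[of t s x] by (simp add: z kd_st val_st nx_st)
    show "kd z = 2 \<Longrightarrow> val z = OLim (\<lambda>x. val (nx z x))"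
      using tval_tnext_lim[of t s] by (simp add: z kd_st val_st nx_st)
    have "tkind t s \<le> 3" by (cases "(t, s)" rule: tkind.cases) auto
    then show "2 < kd z \<Longrightarrow> val (nx z x) = val z"
      using plug_tnext_silent[of t s x] by (simp add: z kd_st val_st nx_st)
    show "r (nx z x) x < r z x" if "kd z \<noteq> 0"
    proof -
      from that have k0: "tkind t s \<noteq> 0" by (simp add: z kd_st)
      let ?t = "fst (tnext t s x)" and ?s = "snd (tnext t s x)" and ?N = "max y x"
      let ?w = "weight ?N (plug ?s ?t)"
      have r': "r (nx z x) x = ?w * ?w + tsize ?t"
        unfolding z nx_st[OF k0] r_st wt_st by simp
      show ?thesis
      proof (cases "tkind t s = 3")
        case True
        then obtain b i g where "t = Add b i g" by (cases "(t, s)" rule: tkind.cases) auto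
        then show ?thesis
          unfolding r' plug_tnext_silent[OF True] by (simp add: z r_st wt_st)
      next
        case False
        then have less: "?w < weight ?N (plug s t)"
          by (intro weight_tnext_less k0) auto
        have "tsize ?t \<le> ?w"
          using tsize_le_weight[of "plug ?s ?t" ?N] by (simp add: tsize_plug)
        then have "?w * ?w + tsize ?t < Suc ?w * Suc ?w" by simp
        also have "\<dots> \<le> weight ?N (plug s t) * weight ?N (plug s t)"
          using less by (intro mult_le_mono) auto
        finally show ?thesis unfolding r' by (simp add: z r_st wt_st)
      qed
    qed
    let ?N = "max y x"
    have wT: "weight ?N (plug s t) \<le> T ?N" by (rule wN) simp
    then have tsT: "tsize t \<le> T ?N" "tsize s \<le> T ?N"
      using tsize_le_weight[of "plug s t" ?N] by (auto simp: tsize_plug)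
    have idx: "idx z x = ?N" by (simp add: z idx_def st)
    show "r z x \<le> L z x"
      unfolding L_def idx unfolding z r_st wt_st using wT tsT by (intro add_mono mult_le_mono)
    have "enc t \<le> code_bound k (T ?N)" "enc s \<le> code_bound k (T ?N)"
      using enc_le_code_bound[OF lt] enc_le_code_bound[OF ls] code_bound_mono[OF tsT(1)]
        code_bound_mono[OF tsT(2)] by (auto intro: order_trans)
    then have "st y t s \<le> npair ?N (npair (code_bound k (T ?N)) (code_bound k (T ?N)))"
      unfolding st_def by (intro npair_mono) auto
    then show "z \<le> M z x" unfolding M_def idx by (simp add: z)
    \<comment> \<open>Taking the maximum with x again changes nothing, so \<open>M\<close> is
      constant along a descent at x.\<close>
    have "idx (nx z x) x = idx z x"
      using nx_st[of t s y x] by (cases "tkind t s = 0") (simp_all add: nx_def z kd_st idx_def st)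
    then show "M (nx z x) x \<le> M z x" unfolding M_def by simp
  qed
  moreover have "tval ` set ts \<subseteq> val ` V"
  proof
    fix \<alpha> assume "\<alpha> \<in> tval ` set ts"
    then obtain t where t: "t \<in> set ts" "\<alpha> = tval t" by auto
    then have "weight N t \<le> T N" for N
      unfolding T_def by (intro member_le_sum_list) auto
    then have "st 0 t Zero \<in> V"
      unfolding V_def using ts[OF t(1)] by (intro CollectI exI[of _ 0] exI[of _ t] exI[of _ Zero]) simp
    then show "\<alpha> \<in> val ` V" using t(2) by (intro image_eqI[of _ _ "st 0 t Zero"]) (simp_all add: val_st)
  qed
  ultimately show ?thesis unfolding codable_def by (intro exI conjI)
qed

section \<open>Combining the two codings\<close>

lemma codable_Phi:
  assumes "1 \<le> k" "finite S" "S \<subseteq> Phi k"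
  shows "codable k S"
proof -
  have "\<forall>\<alpha>\<in>S. \<exists>t. labels_below k t \<and> tval t = \<alpha>"
    using Phi_tval assms(3) by blast
  from bchoice[OF this] obtain tm_of where
    tm: "\<And>\<alpha>. \<alpha> \<in> S \<Longrightarrow> labels_below k (tm_of \<alpha>) \<and> tval (tm_of \<alpha>) = \<alpha>" by blast
  obtain as where as: "set as = S" using finite_list[OF assms(2)] by blast
  have "codable k (tval ` set (map tm_of as))"
    using tm as by (intro codable_terms[OF assms(1)]) auto
  moreover have "S \<subseteq> tval ` set (map tm_of as)"
    using tm as by force
  ultimately show ?thesis by (rule codable_mono)
qed

theorem theorem9p24:
  fixes A :: "cord set"
  assumes "A \<subseteq> Phi_omega" and "downset A" and "bounded_ords A"
  shows "PredR A \<subseteq> Grz (level A + 2)"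
proof (rule PredR_subset_Grz[OF assms(2)])
  fix S assume S: "finite S" "S \<subseteq> A"
  show "codable (level A) S"
  proof (cases "A \<subseteq> Psi_omega")
    case True
    then show ?thesis using S by (intro codable_Psi_omega) auto
  next
    case False
    have "\<exists>k. 1 \<le> k \<and> A \<subseteq> Phi k" using assms(3) unfolding bounded_ords_def by blast
    from LeastI_ex[OF this] have "1 \<le> level A \<and> A \<subseteq> Phi (level A)"
      using False unfolding level_def by simp
    then show ?thesis using S by (intro codable_Phi) auto
  qed
qed

end
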